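(* Let $G$ be a finite group and let $\mathcal{O}$ be a $G$-transfer system. Let $\mathrm{Sub}^{\mathcal{O}}(G)$ be the set of subgroups $H$ of $G$ such that $H\to G$ is in $\mathcal{O}$, and let $\mathrm{Sub}^{\mathcal{O}}(G)/G$ be the set of conjugacy classes of such subgroups. For each $(H)\in \mathrm{Sub}^{\mathcal{O}}(G)/G$ there is an idempotent $e_{[H]^{\mathcal{O}}}\in \underline{A}^{\mathcal{O}}(G/G)\otimes\mathbb{Q}$ (the one described in the context), and together these give a maximal decomposition of the unit into orthogonal idempotents $$1=\sum_{(H)\in \mathrm{Sub}^{\mathcal{O}}(G)/G} e_{[H]^{\mathcal{O}}}\in \underline{A}^{\mathcal{O}}(G/G)\otimes\mathbb{Q}.$$
   Context: A $G$-transfer system $\mathcal{O}$ is a partial order on the set $\mathrm{Sub}(G)$ of subgroups of $G$, written $K\to H$, which refines inclusion ($K\to H$ implies $K\subseteq H$) and satisfies: (conjugation) $K\to H$ implies $gKg^{-1}\to gHg^{-1}$ for all $g\in G$; (restriction) $K\to H$ and $L\subseteq H$ imply $K\cap L\to L$. The set $\mathrm{Sub}^{\mathcal{O}}(G)$ is closed under conjugation. The $\mathcal{O}$-Burnside ring $\underline{A}^{\mathcal{O}}(G/G)$ is the Grothendieck ring (sum = disjoint union, product = cartesian product) of finite $G$-sets all of whose orbits are isomorphic to some $G/K$ with $K\to G$ in $\mathcal{O}$; additively it is free abelian on the isomorphism classes of such orbits $G/K$. The idempotent $e_{[H]^{\mathcal{O}}}$ is the element of $\underline{A}^{\mathcal{O}}(G/G)\otimes\mathbb{Q}$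 which, under the ring isomorphism to the ring of conjugation-invariant functions $\mathrm{Sub}^{\mathcal{O}}(G)\to\mathbb{Q}$ (pointwise operations) induced by $T\mapsto (K\mapsto |T^K|)$, corresponds to the characteristic function $\delta_H$ of the conjugacy class of $H$. A decomposition of $1$ into orthogonal idempotents is maximal if none of the idempotents can be written as a sum of two nonzero orthogonal idempotents. *)

theory Defs
  imports "HOL-Algebra.Algebra" "HOL-Algebra.Algebraic_Closure_Type"
begin

definition conj_subgroup :: "('a, 'b) monoid_scheme \<Rightarrow> 'a \<Rightarrow> 'a set \<Rightarrow> 'a set" where
  "conj_subgroup G g H = g <#\<^bsub>G\<^esub> H #>\<^bsub>G\<^esub> inv\<^bsub>G\<^esub> g"

definition transfer_system ::
  "('a, 'b) monoid_scheme \<Rightarrow> ('a set \<times> 'a set) set \<Rightarrow> bool" where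
  "transfer_system G Tr \<longleftrightarrow>
     partial_order_on {H. subgroup H G} Tr \<and>
     (\<forall>(K, H) \<in> Tr. K \<subseteq> H) \<and>
     (\<forall>(K, H) \<in> Tr. \<forall>g \<in> carrier G. (conj_subgroup G g K, conj_subgroup G g H) \<in> Tr) \<and>
     (\<forall>(K, H) \<in> Tr. \<forall>L. subgroup L G \<and> L \<subseteq> H \<longrightarrow> (K \<inter> L, L) \<in> Tr)"

definition transfer_subgroups ::
  "('a, 'b) monoid_scheme \<Rightarrow> ('a set \<times> 'a set) set \<Rightarrow> 'a set set" where
  "transfer_subgroups G Tr = {H. (H, carrier G) \<in> Tr}"

definition transfer_classes ::
  "('a, 'b) monoid_scheme \<Rightarrow> ('a set \<times> 'a set) set \<Rightarrow> 'a set set set" where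
  "transfer_classes G Tr =
     transfer_subgroups G Tr //
       {(H, K). H \<in> transfer_subgroups G Tr \<and> K \<in> transfer_subgroups G Tr \<and>
                (\<exists>g \<in> carrier G. K = conj_subgroup G g H)}"

text \<open>A pair of an underlying set and an action on it. Actions are represented as in
  \<^locale>\<open>group_action\<close>: each group element acts by a permutation that is extensional on the
  underlying set. Values of the action outside \<open>carrier G\<close> are irrelevant.\<close>

type_synonym ('a, 'x) gset = "'x set \<times> ('a \<Rightarrow> 'x \<Rightarrow> 'x)"

definition finite_gset :: "('a, 'b) monoid_scheme \<Rightarrow> ('a, 'x) gset \<Rightarrow> bool" where
  "finite_gset G = (\<lambda>(E, \<phi>). group_action G E \<phi> \<and> finite E)"

definition gset_iso ::
  "('a, 'b) monoid_scheme \<Rightarrow> ('a, 'x) gset \<Rightarrow> ('a, 'y) gset \<Rightarrow> bool" where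
  "gset_iso G = (\<lambda>(E, \<phi>) (F, \<psi>).
     \<exists>f. bij_betw f E F \<and> (\<forall>g \<in> carrier G. \<forall>x \<in> E. f (\<phi> g x) = \<psi> g (f x)))"

definition coset_gset :: "('a, 'b) monoid_scheme \<Rightarrow> 'a set \<Rightarrow> ('a, 'a set) gset" where
  "coset_gset G K = (lcosets\<^bsub>G\<^esub> K, \<lambda>g. \<lambda>C \<in> lcosets\<^bsub>G\<^esub> K. g <#\<^bsub>G\<^esub> C)"

definition admissible_gset ::
  "('a, 'b) monoid_scheme \<Rightarrow> ('a set \<times> 'a set) set \<Rightarrow> ('a, 'x) gset \<Rightarrow> bool" where
  "admissible_gset G Tr = (\<lambda>(E, \<phi>). finite_gset G (E, \<phi>) \<and>
     (\<forall>A \<in> orbits G E \<phi>. \<exists>K \<in> transfer_subgroups G Tr.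
        gset_iso G (A, \<lambda>g. restrict (\<phi> g) A) (coset_gset G K)))"

definition gset_union :: "('a, 'x) gset \<Rightarrow> ('a, 'y) gset \<Rightarrow> ('a, 'x + 'y) gset" where
  "gset_union = (\<lambda>(E, \<phi>) (F, \<psi>).
     (E <+> F, \<lambda>g. restrict (map_sum (\<phi> g) (\<psi> g)) (E <+> F)))"

definition gset_prod :: "('a, 'x) gset \<Rightarrow> ('a, 'y) gset \<Rightarrow> ('a, 'x \<times> 'y) gset" where
  "gset_prod = (\<lambda>(E, \<phi>) (F, \<psi>).
     (E \<times> F, \<lambda>g. restrict (map_prod (\<phi> g) (\<psi> g)) (E \<times> F)))"

definition trivial_gset :: "'x set \<Rightarrow> ('a, 'x) gset" where
  "trivial_gset E = (E, \<lambda>g. restrict id E)"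

text \<open>Every finite \<open>G\<close>-set is isomorphic to one on a finite set of natural numbers, so an
  isomorphism class of finite \<open>G\<close>-sets is represented by its members with underlying set
  in \<^typ>\<open>nat\<close>.\<close>

definition gset_class ::
  "('a, 'b) monoid_scheme \<Rightarrow> ('a, 'x) gset \<Rightarrow> ('a, nat) gset set" where
  "gset_class G S = {T. finite_gset G T \<and> gset_iso G S T}"

definition gset_semiring ::
  "('a, 'b) monoid_scheme \<Rightarrow> ('a set \<times> 'a set) set \<Rightarrow> ('a, nat) gset set ring" where
  "gset_semiring G Tr =
     \<lparr>carrier = {gset_class G T | T :: ('a, nat) gset. admissible_gset G Tr T},
      monoid.mult = (\<lambda>A B. \<Union>S \<in> A. \<Union>T \<in> B. gset_class G (gset_prod S T)),
      one = gset_class G (trivial_gset {()}),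
      ring.zero = gset_class G (trivial_gset ({} :: unit set)),
      add = (\<lambda>A B. \<Union>S \<in> A. \<Union>T \<in> B. gset_class G (gset_union S T))\<rparr>"

text \<open>Group completion of a commutative semiring: the pair \<open>(a, b)\<close> stands for the formal
  difference \<open>a - b\<close>.\<close>

definition groth_rel :: "('s, 'm) ring_scheme \<Rightarrow> (('s \<times> 's) \<times> ('s \<times> 's)) set" where
  "groth_rel S = {((a, b), (c, d)).
     a \<in> carrier S \<and> b \<in> carrier S \<and> c \<in> carrier S \<and> d \<in> carrier S \<and>
     (\<exists>k \<in> carrier S. a \<oplus>\<^bsub>S\<^esub> d \<oplus>\<^bsub>S\<^esub> k = c \<oplus>\<^bsub>S\<^esub> b \<oplus>\<^bsub>S\<^esub> k)}"

definition groth_ring :: "('s, 'm) ring_scheme \<Rightarrow> ('s \<times> 's) set ring" where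
  "groth_ring S =
     \<lparr>carrier = (carrier S \<times> carrier S) // groth_rel S,
      monoid.mult = (\<lambda>A B. \<Union>(a, b) \<in> A. \<Union>(c, d) \<in> B.
        groth_rel S `` {(a \<otimes>\<^bsub>S\<^esub> c \<oplus>\<^bsub>S\<^esub> b \<otimes>\<^bsub>S\<^esub> d, a \<otimes>\<^bsub>S\<^esub> d \<oplus>\<^bsub>S\<^esub> b \<otimes>\<^bsub>S\<^esub> c)}),
      one = groth_rel S `` {(\<one>\<^bsub>S\<^esub>, \<zero>\<^bsub>S\<^esub>)},
      ring.zero = groth_rel S `` {(\<zero>\<^bsub>S\<^esub>, \<zero>\<^bsub>S\<^esub>)},
      add = (\<lambda>A B. \<Union>(a, b) \<in> A. \<Union>(c, d) \<in> B.
        groth_rel S `` {(a \<oplus>\<^bsub>S\<^esub> c, b \<oplus>\<^bsub>S\<^esub> d)})\<rparr>"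

definition burnside_ring ::
  "('a, 'b) monoid_scheme \<Rightarrow> ('a set \<times> 'a set) set
     \<Rightarrow> (('a, nat) gset set \<times> ('a, nat) gset set) set ring" where
  "burnside_ring G Tr = groth_ring (gset_semiring G Tr)"

text \<open>The tensor product over the integers, for commutative rings: the quotient of the free
  abelian group on \<open>carrier R \<times> carrier S\<close> by the subgroup generated by the biadditivity
  relations, with the product determined by \<open>(a \<otimes> s) (b \<otimes> t) = ab \<otimes> st\<close>.\<close>

definition tensor_free ::
  "('r, 'm) ring_scheme \<Rightarrow> ('s, 'n) ring_scheme \<Rightarrow> ('r \<times> 's \<Rightarrow>\<^sub>0 int) ring" where
  "tensor_free R S =
     \<lparr>carrier = {c. Poly_Mapping.keys c \<subseteq> carrier R \<times> carrier S},
      monoid.mult = (\<lambda>c d. frag_extend (\<lambda>(a, s).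
        frag_extend (\<lambda>(b, t). frag_of (a \<otimes>\<^bsub>R\<^esub> b, s \<otimes>\<^bsub>S\<^esub> t)) d) c),
      one = frag_of (\<one>\<^bsub>R\<^esub>, \<one>\<^bsub>S\<^esub>),
      ring.zero = 0,
      add = (+)\<rparr>"

definition tensor_relators ::
  "('r, 'm) ring_scheme \<Rightarrow> ('s, 'n) ring_scheme \<Rightarrow> ('r \<times> 's \<Rightarrow>\<^sub>0 int) set" where
  "tensor_relators R S =
     {frag_of (a \<oplus>\<^bsub>R\<^esub> b, s) - frag_of (a, s) - frag_of (b, s) | a b s.
        a \<in> carrier R \<and> b \<in> carrier R \<and> s \<in> carrier S} \<union>
     {frag_of (a, s \<oplus>\<^bsub>S\<^esub> t) - frag_of (a, s) - frag_of (a, t) | a s t.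
        a \<in> carrier R \<and> s \<in> carrier S \<and> t \<in> carrier S}"

definition tensor_ring ::
  "('r, 'm) ring_scheme \<Rightarrow> ('s, 'n) ring_scheme \<Rightarrow> ('r \<times> 's \<Rightarrow>\<^sub>0 int) set ring" where
  "tensor_ring R S =
     tensor_free R S Quot generate (add_monoid (tensor_free R S)) (tensor_relators R S)"

definition rat_burnside_ring ::
  "('a, 'b) monoid_scheme \<Rightarrow> ('a set \<times> 'a set) set
     \<Rightarrow> ((('a, nat) gset set \<times> ('a, nat) gset set) set \<times> rat \<Rightarrow>\<^sub>0 int) set ring" where
  "rat_burnside_ring G Tr = tensor_ring (burnside_ring G Tr) (ring_of_type_algebra :: rat ring)"

text \<open>The ring of conjugation-invariant rational functions on the subgroups \<open>K\<close>
  with \<open>K \<rightarrow> G\<close>. Functions are extensional on that set.\<close>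

definition class_function_ring ::
  "('a, 'b) monoid_scheme \<Rightarrow> ('a set \<times> 'a set) set \<Rightarrow> ('a set \<Rightarrow> rat) ring" where
  "class_function_ring G Tr =
     \<lparr>carrier = {f \<in> extensional (transfer_subgroups G Tr).
        \<forall>K \<in> transfer_subgroups G Tr. \<forall>g \<in> carrier G. f (conj_subgroup G g K) = f K},
      monoid.mult = (\<lambda>f f'. \<lambda>K \<in> transfer_subgroups G Tr. f K * f' K),
      one = (\<lambda>K \<in> transfer_subgroups G Tr. 1),
      ring.zero = (\<lambda>K \<in> transfer_subgroups G Tr. 0),
      add = (\<lambda>f f'. \<lambda>K \<in> transfer_subgroups G Tr. f K + f' K)\<rparr>"

definition fixed_points :: "'a set \<Rightarrow> ('a, 'x) gset \<Rightarrow> 'x set" where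
  "fixed_points K = (\<lambda>(E, \<phi>). {x \<in> E. \<forall>k \<in> K. \<phi> k x = x})"

text \<open>The map induced by \<open>T \<mapsto> (K \<mapsto> |T\<^sup>K|)\<close>, on isomorphism classes, on formal differences of
  these, and on the tensor product with the rationals. In each step \<^const>\<open>the_elem\<close> selects
  the common value on all representatives.\<close>

definition class_mark :: "'a set \<Rightarrow> ('a, nat) gset set \<Rightarrow> nat" where
  "class_mark K A = the_elem ((\<lambda>T. card (fixed_points K T)) ` A)"

definition burnside_mark ::
  "'a set \<Rightarrow> (('a, nat) gset set \<times> ('a, nat) gset set) set \<Rightarrow> int" where
  "burnside_mark K C = the_elem ((\<lambda>(A, B). int (class_mark K A) - int (class_mark K B)) ` C)"

definition mark_map ::
  "('a, 'b) monoid_scheme \<Rightarrow> ('a set \<times> 'a set) set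
     \<Rightarrow> ((('a, nat) gset set \<times> ('a, nat) gset set) set \<times> rat \<Rightarrow>\<^sub>0 int) set
     \<Rightarrow> 'a set \<Rightarrow> rat" where
  "mark_map G Tr Z = (\<lambda>K \<in> transfer_subgroups G Tr.
     the_elem ((\<lambda>c. \<Sum>p \<in> Poly_Mapping.keys c.
       of_int (Poly_Mapping.lookup c p) * (of_int (burnside_mark K (fst p)) * snd p)) ` Z))"

definition char_function ::
  "('a, 'b) monoid_scheme \<Rightarrow> ('a set \<times> 'a set) set \<Rightarrow> 'a set set \<Rightarrow> 'a set \<Rightarrow> rat" where
  "char_function G Tr \<C> = (\<lambda>K \<in> transfer_subgroups G Tr. if K \<in> \<C> then 1 else 0)"

definition burnside_idempotent ::
  "('a, 'b) monoid_scheme \<Rightarrow> ('a set \<times> 'a set) set \<Rightarrow> 'a set set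
     \<Rightarrow> ((('a, nat) gset set \<times> ('a, nat) gset set) set \<times> rat \<Rightarrow>\<^sub>0 int) set" where
  "burnside_idempotent G Tr \<C> =
     inv_into (carrier (rat_burnside_ring G Tr)) (mark_map G Tr) (char_function G Tr \<C>)"

definition ring_idempotent :: "('r, 'm) ring_scheme \<Rightarrow> 'r \<Rightarrow> bool" where
  "ring_idempotent R e \<longleftrightarrow> e \<in> carrier R \<and> e \<otimes>\<^bsub>R\<^esub> e = e"

definition ring_orthogonal :: "('r, 'm) ring_scheme \<Rightarrow> 'r \<Rightarrow> 'r \<Rightarrow> bool" where
  "ring_orthogonal R e f \<longleftrightarrow> e \<otimes>\<^bsub>R\<^esub> f = \<zero>\<^bsub>R\<^esub> \<and> f \<otimes>\<^bsub>R\<^esub> e = \<zero>\<^bsub>R\<^esub>"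

definition orthogonal_decomposition ::
  "('r, 'm) ring_scheme \<Rightarrow> 'i set \<Rightarrow> ('i \<Rightarrow> 'r) \<Rightarrow> bool" where
  "orthogonal_decomposition R I e \<longleftrightarrow>
     finite I \<and>
     (\<forall>i \<in> I. ring_idempotent R (e i)) \<and>
     (\<forall>i \<in> I. \<forall>j \<in> I. i \<noteq> j \<longrightarrow> ring_orthogonal R (e i) (e j)) \<and>
     \<one>\<^bsub>R\<^esub> = (\<Oplus>\<^bsub>R\<^esub>i \<in> I. e i)"

definition maximal_orthogonal_decomposition ::
  "('r, 'm) ring_scheme \<Rightarrow> 'i set \<Rightarrow> ('i \<Rightarrow> 'r) \<Rightarrow> bool" where
  "maximal_orthogonal_decomposition R I e \<longleftrightarrow>
     orthogonal_decomposition R I e \<and>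
     (\<forall>i \<in> I. \<not> (\<exists>a b. ring_idempotent R a \<and> ring_idempotent R b \<and>
        a \<noteq> \<zero>\<^bsub>R\<^esub> \<and> b \<noteq> \<zero>\<^bsub>R\<^esub> \<and> ring_orthogonal R a b \<and> e i = a \<oplus>\<^bsub>R\<^esub> b))"

end

theory Submission
  imports Defs
begin

text \<open>On the semiring of isomorphism classes of admissible \<open>G\<close>-sets, on its group completion, and
  on the tensor product with the rationals, the marks \<open>T \<mapsto> |T\<^sup>K|\<close> for \<open>K \<rightarrow> G\<close> are jointly
  injective homomorphisms. For the semiring this is Burnside's theorem: all stabilizers of
  admissible \<open>G\<close>-sets lie in \<open>Sub\<^sup>O(G)\<close>, and orbits whose stabilizer is maximal can be matched and
  removed one by one. Joint injectivity passes to the group completion, and to the tensor product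
  because every tensor is of the form \<open>x \<otimes> 1/N\<close> (common denominator). The image of the mark
  homomorphism is a \<open>\<rat>\<close>-algebra of class functions. It separates nonconjugate subgroups \<open>H\<close>, \<open>K\<close>,
  as a mark of \<open>G/H\<close> or \<open>G/K\<close> vanishes at exactly one of them; hence it contains all class
  functions.\<close>

section \<open>Rings with jointly injective homomorphisms\<close>

text \<open>The rings are sets of equivalence classes whose operations take unions over all
  representatives, and marks are read off with \<open>the_elem\<close>. To avoid proving ring laws
  and well-definedness anew at each layer, a layer supplies only closure, the marks of its
  operations and joint injectivity; a class of either quotient turns out to be a fibre of the marks.
  Ring laws and claims about idempotents are then checked on numbers. The axioms of a transfer
  system enter as closure properties of \<open>transfer_subgroups G Tr\<close>. Restriction and
  transitivity give intersections, which are the stabilizers in products. Conjugation gives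
  conjugates, which are the stabilizers along an orbit. Reflexivity gives the whole group, which is
  the stabilizer in the one-point set. Surjectivity is interpolation. An affine function of one mark
  is 1 at \<open>H\<close> and 0 at \<open>K\<close>, products of these isolate a conjugacy class,
  and rational scalars are there for the division.\<close>

locale joint_embedding =
  fixes R :: "('r, 'm) ring_scheme" (structure)
    and J :: "'k set"
    and m :: "'k \<Rightarrow> 'r \<Rightarrow> 'v :: comm_semiring_1"
  assumes zero_closed: "\<zero> \<in> carrier R"
    and one_closed: "\<one> \<in> carrier R"
    and add_closed: "\<And>x y. x \<in> carrier R \<Longrightarrow> y \<in> carrier R \<Longrightarrow> x \<oplus> y \<in> carrier R"
    and mult_closed: "\<And>x y. x \<in> carrier R \<Longrightarrow> y \<in> carrier R \<Longrightarrow> x \<otimes> y \<in> carrier R"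
    and m_zero: "\<And>k. k \<in> J \<Longrightarrow> m k \<zero> = 0"
    and m_one: "\<And>k. k \<in> J \<Longrightarrow> m k \<one> = 1"
    and m_add: "\<And>k x y. k \<in> J \<Longrightarrow> x \<in> carrier R \<Longrightarrow> y \<in> carrier R \<Longrightarrow> m k (x \<oplus> y) = m k x + m k y"
    and m_mult: "\<And>k x y. k \<in> J \<Longrightarrow> x \<in> carrier R \<Longrightarrow> y \<in> carrier R \<Longrightarrow> m k (x \<otimes> y) = m k x * m k y"
    and m_inj: "\<And>x y. x \<in> carrier R \<Longrightarrow> y \<in> carrier R \<Longrightarrow> (\<And>k. k \<in> J \<Longrightarrow> m k x = m k y) \<Longrightarrow> x = y"
begin

lemmas closed = zero_closed one_closed add_closed mult_closed
lemmas m_hom = m_zero m_one m_add m_mult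

end

text \<open>Natural-number marks fit only the weaker locale, hence the split. Negatives are asked
  for through their values alone; joint injectivity turns them into additive inverses.\<close>

locale joint_ring_embedding = joint_embedding R J m
  for R :: "('r, 'm) ring_scheme" (structure)
    and J :: "'k set"
    and m :: "'k \<Rightarrow> 'r \<Rightarrow> 'v :: comm_ring_1" +
  assumes ex_neg: "\<And>x. x \<in> carrier R \<Longrightarrow> \<exists>y \<in> carrier R. \<forall>k \<in> J. m k y = - m k x"
begin

text \<open>Each mark turns a ring law into an identity in a commutative ring, and
  \<open>m_inj\<close> brings it back. Only additive inverses need an existence argument, supplied
  by \<open>ex_neg\<close>.\<close>

lemma cring: "cring R"
proof (rule cringI)
  show "abelian_group R"
  proof (rule abelian_groupI)
    fix x assume x: "x \<in> carrier R"
    obtain y where y: "y \<in> carrier R" "\<And>k. k \<in> J \<Longrightarrow> m k y = - m k x"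
      using ex_neg[OF x] by blast
    have "y \<oplus> x = \<zero>"
      by (rule m_inj) (use x y in \<open>auto simp: closed m_hom\<close>)
    then show "\<exists>y\<in>carrier R. y \<oplus> x = \<zero>" using y by blast
  qed (auto simp: closed m_hom algebra_simps intro!: m_inj)
  show "comm_monoid R"
    by unfold_locales (auto simp: closed m_hom algebra_simps intro!: m_inj)
  fix x y z assume "x \<in> carrier R" "y \<in> carrier R" "z \<in> carrier R"
  then show "(x \<oplus> y) \<otimes> z = x \<otimes> z \<oplus> y \<otimes> z"
    by (intro m_inj) (auto simp: closed m_hom algebra_simps)
qed

end

text \<open>Serves for \<open>mark_map\<close>, which is a restricted function and agrees with the
  evaluation of tensors only at indices in \<open>J\<close>.\<close>

lemma joint_ring_embedding_cong:
  assumes "joint_ring_embedding R J m" "\<And>k x. k \<in> J \<Longrightarrow> m' k x = m k x"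
  shows "joint_ring_embedding R J m'"
proof -
  interpret joint_ring_embedding R J m by (rule assms(1))
  show ?thesis
    by unfold_locales (use ex_neg m_inj in \<open>auto simp: assms(2) closed m_hom\<close>)
qed

lemma (in joint_ring_embedding) m_finsum:
  assumes "k \<in> J" "finite A" "\<And>i. i \<in> A \<Longrightarrow> f i \<in> carrier R"
  shows "m k (\<Oplus>i\<in>A. f i) = (\<Sum>i\<in>A. m k (f i))"
proof -
  interpret cring R by (rule cring)
  show ?thesis
    using assms(2,3) by (induction rule: finite_induct) (auto simp: m_hom assms(1) Pi_def)
qed

section \<open>Group completion\<close>

locale joint_nat_embedding = joint_embedding S J m
  for S :: "('s, 'm) ring_scheme" (structure)
    and J :: "'k set"
    and m :: "'k \<Rightarrow> 's \<Rightarrow> nat"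
begin

definition diff :: "'k \<Rightarrow> 's \<times> 's \<Rightarrow> int" where
  "diff k = (\<lambda>(a, b). int (m k a) - int (m k b))"

text \<open>After taking marks, the auxiliary summand cancels in the natural numbers. Conversely,
  equal differences of marks give equal sums by \<open>m_inj\<close>, with zero as auxiliary
  summand.\<close>

lemma groth_rel_iff:
  "(p, q) \<in> groth_rel S \<longleftrightarrow>
     p \<in> carrier S \<times> carrier S \<and> q \<in> carrier S \<times> carrier S \<and> (\<forall>k \<in> J. diff k p = diff k q)"
proof -
  obtain a b c d where pq: "p = (a, b)" "q = (c, d)" by (meson surj_pair)
  show ?thesis
  proof (cases "a \<in> carrier S \<and> b \<in> carrier S \<and> c \<in> carrier S \<and> d \<in> carrier S")
    case True
    have "(\<exists>k\<in>carrier S. a \<oplus> d \<oplus> k = c \<oplus> b \<oplus> k) \<longleftrightarrow> (\<forall>k\<in>J. diff k p = diff k q)" (is "?L = ?R")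
    proof
      assume ?L
      then obtain z where z: "z \<in> carrier S" "a \<oplus> d \<oplus> z = c \<oplus> b \<oplus> z" by blast
      show ?R
      proof
        fix k assume k: "k \<in> J"
        have "m k (a \<oplus> d \<oplus> z) = m k (c \<oplus> b \<oplus> z)" using z(2) by simp
        then have "m k a + m k d = m k c + m k b"
          using k True z(1) by (simp add: m_hom closed)
        then show "diff k p = diff k q"
          by (simp add: pq diff_def)
      qed
    next
      assume r: ?R
      have "a \<oplus> d \<oplus> \<zero> = c \<oplus> b \<oplus> \<zero>"
      proof (rule m_inj)
        fix k assume "k \<in> J"
        then show "m k (a \<oplus> d \<oplus> \<zero>) = m k (c \<oplus> b \<oplus> \<zero>)"
          using r True by (force simp add: m_hom closed pq diff_def)
      qed (use True in \<open>auto simp: closed\<close>)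
      then show ?L using zero_closed by blast
    qed
    then show ?thesis using True by (simp add: groth_rel_def pq)
  qed (auto simp: groth_rel_def pq)
qed

abbreviation cls :: "'s \<times> 's \<Rightarrow> ('s \<times> 's) set" where
  "cls p \<equiv> groth_rel S `` {p}"

text \<open>Classes as fibres of the marks: well-definedness of the operations below reduces to
  comparing numbers.\<close>

lemma cls_eq:
  "p \<in> carrier S \<times> carrier S \<Longrightarrow>
    cls p = {q \<in> carrier S \<times> carrier S. \<forall>k\<in>J. diff k q = diff k p}"
  by (auto simp: groth_rel_iff Image_singleton)

lemma cls_eqI:
  "p \<in> carrier S \<times> carrier S \<Longrightarrow> q \<in> carrier S \<times> carrier S \<Longrightarrow>
    (\<And>k. k \<in> J \<Longrightarrow> diff k p = diff k q) \<Longrightarrow> cls p = cls q"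
  by (auto simp: cls_eq)

lemma the_elem_diff_cls:
  assumes "p \<in> carrier S \<times> carrier S" "k \<in> J"
  shows "the_elem (diff k ` cls p) = diff k p"
proof -
  have "diff k ` cls p = {diff k p}"
    using assms by (auto simp: cls_eq)
  then show ?thesis by simp
qed

lemma groth_carrierE:
  assumes "C \<in> carrier (groth_ring S)"
  obtains a b where "C = cls (a, b)" "a \<in> carrier S" "b \<in> carrier S"
  using assms by (auto simp: groth_ring_def quotient_def)

lemma groth_carrierI:
  "a \<in> carrier S \<Longrightarrow> b \<in> carrier S \<Longrightarrow> cls (a, b) \<in> carrier (groth_ring S)"
  by (auto simp: groth_ring_def quotient_def)

lemma groth_add:
  assumes "a \<in> carrier S" "b \<in> carrier S" "c \<in> carrier S" "d \<in> carrier S"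
  shows "cls (a, b) \<oplus>\<^bsub>groth_ring S\<^esub> cls (c, d) = cls (a \<oplus> c, b \<oplus> d)"
proof -
  have *: "cls (a' \<oplus> c', b' \<oplus> d') = cls (a \<oplus> c, b \<oplus> d)"
    if "(a', b') \<in> cls (a, b)" "(c', d') \<in> cls (c, d)" for a' b' c' d'
  proof (rule cls_eqI)
    fix k assume k: "k \<in> J"
    have eq: "diff k (a', b') = diff k (a, b)" "diff k (c', d') = diff k (c, d)"
      using that k assms by (auto simp: cls_eq)
    have "a' \<in> carrier S" "b' \<in> carrier S" "c' \<in> carrier S" "d' \<in> carrier S"
      using that assms by (auto simp: cls_eq)
    with eq show "diff k (a' \<oplus> c', b' \<oplus> d') = diff k (a \<oplus> c, b \<oplus> d)"
      using k assms by (auto simp: diff_def m_hom)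
  qed (use that assms in \<open>auto simp: cls_eq closed\<close>)
  have "(a, b) \<in> cls (a, b)" "(c, d) \<in> cls (c, d)" using assms by (auto simp: cls_eq)
  then have "(\<Union>(a', b')\<in>cls (a, b). \<Union>(c', d')\<in>cls (c, d). cls (a' \<oplus> c', b' \<oplus> d')) = cls (a \<oplus> c, b \<oplus> d)"
    using * by fast
  then show ?thesis by (simp add: groth_ring_def)
qed

lemma groth_mult:
  assumes "a \<in> carrier S" "b \<in> carrier S" "c \<in> carrier S" "d \<in> carrier S"
  shows "cls (a, b) \<otimes>\<^bsub>groth_ring S\<^esub> cls (c, d) = cls (a \<otimes> c \<oplus> b \<otimes> d, a \<otimes> d \<oplus> b \<otimes> c)"
proof -
  \<comment> \<open>The expansion of \<open>(a - b) (c - d)\<close>: marks of formal differences are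
    multiplicative.\<close>
  have d: "diff k (a \<otimes> c \<oplus> b \<otimes> d, a \<otimes> d \<oplus> b \<otimes> c) = diff k (a, b) * diff k (c, d)"
    if "a \<in> carrier S" "b \<in> carrier S" "c \<in> carrier S" "d \<in> carrier S" "k \<in> J" for a b c d k
    using that by (auto simp: diff_def m_hom closed algebra_simps)
  have *: "cls (a' \<otimes> c' \<oplus> b' \<otimes> d', a' \<otimes> d' \<oplus> b' \<otimes> c') = cls (a \<otimes> c \<oplus> b \<otimes> d, a \<otimes> d \<oplus> b \<otimes> c)"
    if "(a', b') \<in> cls (a, b)" "(c', d') \<in> cls (c, d)" for a' b' c' d'
  proof (rule cls_eqI)
    fix k assume k: "k \<in> J"
    have "diff k (a', b') = diff k (a, b)" "diff k (c', d') = diff k (c, d)"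
      using that k assms by (auto simp: cls_eq)
    moreover have "a' \<in> carrier S" "b' \<in> carrier S" "c' \<in> carrier S" "d' \<in> carrier S"
      using that assms by (auto simp: cls_eq)
    ultimately show "diff k (a' \<otimes> c' \<oplus> b' \<otimes> d', a' \<otimes> d' \<oplus> b' \<otimes> c') = diff k (a \<otimes> c \<oplus> b \<otimes> d, a \<otimes> d \<oplus> b \<otimes> c)"
      using k assms d by metis
  qed (use that assms in \<open>auto simp: cls_eq closed\<close>)
  have "(a, b) \<in> cls (a, b)" "(c, d) \<in> cls (c, d)" using assms by (auto simp: cls_eq)
  then have "(\<Union>(a', b')\<in>cls (a, b). \<Union>(c', d')\<in>cls (c, d). cls (a' \<otimes> c' \<oplus> b' \<otimes> d', a' \<otimes> d' \<oplus> b' \<otimes> c'))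
      = cls (a \<otimes> c \<oplus> b \<otimes> d, a \<otimes> d \<oplus> b \<otimes> c)"
    using * by fast
  then show ?thesis by (simp add: groth_ring_def)
qed

lemma groth_zero: "\<zero>\<^bsub>groth_ring S\<^esub> = cls (\<zero>, \<zero>)"
  and groth_one: "\<one>\<^bsub>groth_ring S\<^esub> = cls (\<one>, \<zero>)"
  by (simp_all add: groth_ring_def)

text \<open>With \<open>k\<close> and \<open>k'\<close> conjugate subgroups, this carries
  conjugation invariance from the semiring to its completion.\<close>

lemma the_elem_diff_cong:
  assumes "C \<in> carrier (groth_ring S)" "k \<in> J" "k' \<in> J" "\<And>x. x \<in> carrier S \<Longrightarrow> m k x = m k' x"
  shows "the_elem ((\<lambda>(a, b). int (m k a) - int (m k b)) ` C) =
    the_elem ((\<lambda>(a, b). int (m k' a) - int (m k' b)) ` C)"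
  using assms(1)
proof (rule groth_carrierE)
  fix a b assume "C = cls (a, b)" "a \<in> carrier S" "b \<in> carrier S"
  then show ?thesis
    using assms(2-4) the_elem_diff_cls[of "(a, b)", unfolded diff_def] by simp
qed

text \<open>The marks are spelled out instead of written with \<open>diff\<close>, so that they are
  literally \<open>burnside_mark\<close> when \<open>m\<close> is \<open>class_mark\<close>.
  Swapping the components of a pair negates its mark.\<close>

theorem groth_embedding:
  "joint_ring_embedding (groth_ring S) J
     (\<lambda>k C. the_elem ((\<lambda>(a, b). int (m k a) - int (m k b)) ` C))"
proof -
  have md: "the_elem ((\<lambda>(a, b). int (m k a) - int (m k b)) ` cls (a, b)) = int (m k a) - int (m k b)"
    if "a \<in> carrier S" "b \<in> carrier S" "k \<in> J" for k a b
    using the_elem_diff_cls[of "(a, b)" k] that by (simp add: diff_def)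
  show ?thesis
  proof unfold_locales
    fix x assume "x \<in> carrier (groth_ring S)"
    then obtain a b where x: "x = cls (a, b)" "a \<in> carrier S" "b \<in> carrier S"
      by (rule groth_carrierE)
    show "\<exists>y\<in>carrier (groth_ring S). \<forall>k\<in>J.
       the_elem ((\<lambda>(a, b). int (m k a) - int (m k b)) ` y) = - the_elem ((\<lambda>(a, b). int (m k a) - int (m k b)) ` x)"
      by (rule bexI[of _ "cls (b, a)"]) (use x in \<open>auto simp: md groth_carrierI\<close>)
  next
    fix x y
    assume xy: "x \<in> carrier (groth_ring S)" "y \<in> carrier (groth_ring S)"
      and eq: "\<And>k. k \<in> J \<Longrightarrow> the_elem ((\<lambda>(a, b). int (m k a) - int (m k b)) ` x)
                            = the_elem ((\<lambda>(a, b). int (m k a) - int (m k b)) ` y)"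
    obtain a b where x: "x = cls (a, b)" "a \<in> carrier S" "b \<in> carrier S"
      using xy(1) by (rule groth_carrierE)
    obtain c d where y: "y = cls (c, d)" "c \<in> carrier S" "d \<in> carrier S"
      using xy(2) by (rule groth_carrierE)
    show "x = y"
      unfolding x y using eq x y by (intro cls_eqI) (auto simp: md diff_def)
  qed (auto simp: groth_zero groth_one groth_add groth_mult groth_carrierI closed md m_hom algebra_simps
         elim!: groth_carrierE)
qed

end

section \<open>Extension of scalars to the rationals\<close>

locale joint_int_embedding = joint_ring_embedding R J m
  for R :: "('r, 'm) ring_scheme" (structure)
    and J :: "'k set"
    and m :: "'k \<Rightarrow> 'r \<Rightarrow> int"
begin

section \<open>Evaluations on the free abelian group and the subgroup of relations\<close>

abbreviation Q :: "rat ring" where "Q \<equiv> ring_of_type_algebra"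
abbreviation F :: "('r \<times> rat \<Rightarrow>\<^sub>0 int) ring" where "F \<equiv> tensor_free R Q"
text \<open>By construction only an additive subgroup. That the product descends to the quotient
  follows once \<open>I_eq_kernel\<close> identifies it as the common kernel of the multiplicative
  maps \<open>ev k\<close>.\<close>

definition I :: "('r \<times> rat \<Rightarrow>\<^sub>0 int) set" where
  "I = generate (add_monoid F) (tensor_relators R Q)"

text \<open>The linear extension of the biadditive pairing \<open>m k a * s\<close>, in the very
  form that occurs inside \<open>mark_map\<close>.\<close>

definition ev :: "'k \<Rightarrow> ('r \<times> rat \<Rightarrow>\<^sub>0 int) \<Rightarrow> rat" where
  "ev k c = (\<Sum>p\<in>Poly_Mapping.keys c.
     of_int (Poly_Mapping.lookup c p) * (of_int (m k (fst p)) * snd p))"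

lemma ev_superset:
  "finite A \<Longrightarrow> Poly_Mapping.keys c \<subseteq> A \<Longrightarrow>
    ev k c = (\<Sum>p\<in>A. of_int (Poly_Mapping.lookup c p) * (of_int (m k (fst p)) * snd p))"
  unfolding ev_def by (rule sum.mono_neutral_left) (auto simp: in_keys_iff)

lemma ev_diff: "ev k (c - d) = ev k c - ev k d"
proof -
  let ?A = "Poly_Mapping.keys c \<union> Poly_Mapping.keys d"
  have "Poly_Mapping.keys (c - d) \<subseteq> ?A" by (rule keys_diff)
  then show ?thesis
    by (simp add: ev_superset[of ?A] lookup_minus left_diff_distrib sum_subtractf)
qed

lemma ev_0 [simp]: "ev k 0 = 0"
  by (simp add: ev_def)

lemma ev_minus: "ev k (- c) = - ev k c"
  using ev_diff[of k 0 c] by simp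

lemma ev_add: "ev k (c + d) = ev k c + ev k d"
  using ev_diff[of k c "- d"] by (simp add: ev_minus)

lemma ev_frag_of [simp]: "ev k (frag_of (a, s)) = of_int (m k a) * s"
  by (simp add: ev_def)

lemma Q_simps: "carrier Q = UNIV" "s \<otimes>\<^bsub>Q\<^esub> t = s * t" "s \<oplus>\<^bsub>Q\<^esub> t = s + t" "\<one>\<^bsub>Q\<^esub> = 1" "\<zero>\<^bsub>Q\<^esub> = 0"
  by (simp_all add: ring_of_type_algebra_def)

lemma F_simps:
  "carrier F = {c. Poly_Mapping.keys c \<subseteq> carrier R \<times> UNIV}" "c \<oplus>\<^bsub>F\<^esub> d = c + d" "\<zero>\<^bsub>F\<^esub> = 0"
  "\<one>\<^bsub>F\<^esub> = frag_of (\<one>, 1)"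
  by (simp_all add: tensor_free_def Q_simps)

lemma F_closed:
  "0 \<in> carrier F" "c \<in> carrier F \<Longrightarrow> d \<in> carrier F \<Longrightarrow> c + d \<in> carrier F"
  "c \<in> carrier F \<Longrightarrow> d \<in> carrier F \<Longrightarrow> c - d \<in> carrier F"
  "c \<in> carrier F \<Longrightarrow> - c \<in> carrier F"
  "frag_of (a, s) \<in> carrier F \<longleftrightarrow> a \<in> carrier R"
  using keys_add[of c d] keys_diff[of c d] by (auto simp: F_simps)

lemma add_monoid_F: "add_monoid F = free_Abelian_group (carrier R \<times> UNIV)"
  by (simp add: tensor_free_def free_Abelian_group_def Q_simps)

lemma inv_F: "c \<in> carrier F \<Longrightarrow> inv\<^bsub>add_monoid F\<^esub> c = - c"
  unfolding add_monoid_F by (simp add: F_simps)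

lemma F_induct [consumes 1, case_names zero frag diff]:
  assumes "c \<in> carrier F" "P 0" "\<And>a s. a \<in> carrier R \<Longrightarrow> P (frag_of (a, s))"
    "\<And>c d. c \<in> carrier F \<Longrightarrow> d \<in> carrier F \<Longrightarrow> P c \<Longrightarrow> P d \<Longrightarrow> P (c - d)"
  shows "P c"
proof -
  have "c \<in> carrier F \<and> P c"
  proof (rule frag_induction[of c "carrier R \<times> UNIV"])
    show "Poly_Mapping.keys c \<subseteq> carrier R \<times> UNIV" using assms(1) by (simp add: F_simps)
  qed (use assms in \<open>auto simp: F_closed\<close>)
  then show ?thesis ..
qed

lemma F_mult_frag:
  "frag_of (a, s) \<otimes>\<^bsub>F\<^esub> frag_of (b, t) = frag_of (a \<otimes> b, s * t)"
  "0 \<otimes>\<^bsub>F\<^esub> d = 0" "c \<otimes>\<^bsub>F\<^esub> 0 = 0"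
  "(c - c') \<otimes>\<^bsub>F\<^esub> d = c \<otimes>\<^bsub>F\<^esub> d - c' \<otimes>\<^bsub>F\<^esub> d"
  "frag_of (a, s) \<otimes>\<^bsub>F\<^esub> (d - d') = frag_of (a, s) \<otimes>\<^bsub>F\<^esub> d - frag_of (a, s) \<otimes>\<^bsub>F\<^esub> d'"
  by (simp_all add: tensor_free_def Q_simps frag_extend_diff frag_extend_eq_0)

text \<open>Induction on both factors. \<open>F_mult_frag\<close> expands a difference on the right
  only behind a generator on the left, which is why the left factor comes first.\<close>

lemma F_mult:
  assumes "c \<in> carrier F" "d \<in> carrier F"
  shows "c \<otimes>\<^bsub>F\<^esub> d \<in> carrier F \<and> (\<forall>k\<in>J. ev k (c \<otimes>\<^bsub>F\<^esub> d) = ev k c * ev k d)"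
  using assms(1)
proof (induction rule: F_induct)
  case (frag a s)
  from assms(2) show ?case
    by (induction rule: F_induct)
      (use frag in \<open>auto simp: F_mult_frag F_closed closed m_hom ev_diff algebra_simps\<close>)
qed (auto simp: F_mult_frag F_closed ev_diff algebra_simps)

lemma relators_F: "tensor_relators R Q \<subseteq> carrier F"
  by (auto simp: tensor_relators_def Q_simps F_closed closed)

lemma subgroup_I: "subgroup I (add_monoid F)"
  unfolding I_def
proof (rule group.generate_is_subgroup)
  show "group (add_monoid F)" unfolding add_monoid_F by simp
qed (use relators_F in simp)

lemma I_subset: "I \<subseteq> carrier F"
  using subgroup.subset[OF subgroup_I] by simp

lemma I_zero: "0 \<in> I"
  using subgroup.one_closed[OF subgroup_I] by (simp add: F_simps)

lemma I_add: "c \<in> I \<Longrightarrow> d \<in> I \<Longrightarrow> c + d \<in> I"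
  using subgroup.m_closed[OF subgroup_I] by (simp add: F_simps)

lemma I_uminus: "c \<in> I \<Longrightarrow> - c \<in> I"
  using subgroup.m_inv_closed[OF subgroup_I] inv_F I_subset by fastforce

lemma I_diff: "c \<in> I \<Longrightarrow> d \<in> I \<Longrightarrow> c - d \<in> I"
  using I_add[of c "- d"] I_uminus by simp

lemma ev_relator: "h \<in> tensor_relators R Q \<Longrightarrow> k \<in> J \<Longrightarrow> ev k h = 0"
  unfolding tensor_relators_def Q_simps by (elim UnE; clarify) (simp_all add: ev_diff ev_add m_hom algebra_simps)

lemma ev_I: "c \<in> I \<Longrightarrow> k \<in> J \<Longrightarrow> ev k c = 0"
  unfolding I_def
proof (induction rule: generate.induct)
  case (inv h)
  then have "inv\<^bsub>add_monoid F\<^esub> h = - h" using relators_F inv_F by blast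
  then show ?case using inv ev_relator by (simp add: ev_minus)
qed (auto simp: F_simps ev_add ev_relator)

lemma relator_I: "h \<in> tensor_relators R Q \<Longrightarrow> h \<in> I"
  unfolding I_def by (rule generate.incl)

section \<open>Calculation modulo the biadditivity relations\<close>

definition cong :: "('r \<times> rat \<Rightarrow>\<^sub>0 int) \<Rightarrow> ('r \<times> rat \<Rightarrow>\<^sub>0 int) \<Rightarrow> bool" (infix "\<doteq>" 50) where
  "c \<doteq> d \<longleftrightarrow> c - d \<in> I"

lemma cong_refl: "c \<doteq> c" by (simp add: cong_def I_zero)

lemma cong_sym: "c \<doteq> d \<Longrightarrow> d \<doteq> c"
  using I_uminus[of "c - d"] by (simp add: cong_def)

lemma cong_trans [trans]: "c \<doteq> d \<Longrightarrow> d \<doteq> e \<Longrightarrow> c \<doteq> e"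
  using I_add[of "c - d" "d - e"] by (simp add: cong_def)

lemma cong_add: "c \<doteq> d \<Longrightarrow> c' \<doteq> d' \<Longrightarrow> c + c' \<doteq> d + d'"
  using I_add[of "c - d" "c' - d'"] by (simp add: cong_def algebra_simps)

lemma cong_diff: "c \<doteq> d \<Longrightarrow> c' \<doteq> d' \<Longrightarrow> c - c' \<doteq> d - d'"
  using I_diff[of "c - d" "c' - d'"] by (simp add: cong_def algebra_simps)

lemma cong_add_left: "a \<in> carrier R \<Longrightarrow> b \<in> carrier R \<Longrightarrow> frag_of (a \<oplus> b, s) \<doteq> frag_of (a, s) + frag_of (b, s)"
proof -
  assume "a \<in> carrier R" "b \<in> carrier R"
  then have "frag_of (a \<oplus> b, s) - frag_of (a, s) - frag_of (b, s) \<in> I"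
    by (intro relator_I, unfold tensor_relators_def Q_simps) blast
  then show ?thesis by (simp add: cong_def algebra_simps)
qed

lemma cong_add_right: "a \<in> carrier R \<Longrightarrow> frag_of (a, s + t) \<doteq> frag_of (a, s) + frag_of (a, t)"
proof -
  assume "a \<in> carrier R"
  then have "frag_of (a, s + t) - frag_of (a, s) - frag_of (a, t) \<in> I"
    by (intro relator_I, unfold tensor_relators_def Q_simps) blast
  then show ?thesis by (simp add: cong_def algebra_simps)
qed

text \<open>Additivity applied to zero plus zero puts minus this generator in
  \<open>I\<close>.\<close>

lemma cong_zero_left: "frag_of (\<zero>, s) \<doteq> 0"
  using I_uminus[OF cong_add_left[of \<zero> \<zero> s, unfolded cong_def]] zero_closed m_inj[of "\<zero> \<oplus> \<zero>" \<zero>]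
  by (simp add: cong_def closed m_hom)

lemma cong_zero_right: "a \<in> carrier R \<Longrightarrow> frag_of (a, 0) \<doteq> 0"
  using I_uminus[OF cong_add_right[of a 0 0, unfolded cong_def]]
  by (simp add: cong_def closed m_hom)

text \<open>Moves the factor \<open>n\<close> across the tensor sign: \<open>y\<close> is the
  \<open>n\<close>-fold sum of \<open>x\<close>, and one \<open>y\<close> serves for every
  \<open>s\<close>.\<close>

lemma nat_multiple:
  "x \<in> carrier R \<Longrightarrow> \<exists>y\<in>carrier R. \<forall>s. frag_of (y, s) \<doteq> frag_of (x, of_nat n * s)"
proof (induction n)
  case 0
  then have "frag_of (\<zero>, s) \<doteq> frag_of (x, of_nat 0 * s)" for s
    using cong_trans[OF cong_zero_left cong_sym[OF cong_zero_right]] by simp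
  then show ?case using zero_closed by blast
next
  case (Suc n)
  then obtain y where y: "y \<in> carrier R" "\<And>s. frag_of (y, s) \<doteq> frag_of (x, of_nat n * s)" by blast
  have "frag_of (y \<oplus> x, s) \<doteq> frag_of (x, of_nat (Suc n) * s)" for s
  proof -
    have "frag_of (y \<oplus> x, s) \<doteq> frag_of (y, s) + frag_of (x, s)"
      using y Suc by (intro cong_add_left)
    also have "\<dots> \<doteq> frag_of (x, of_nat n * s) + frag_of (x, s)"
      using y by (intro cong_add cong_refl)
    also have "\<dots> \<doteq> frag_of (x, of_nat n * s + s)"
      using Suc by (intro cong_sym[OF cong_add_right])
    finally show ?thesis by (simp add: algebra_simps)
  qed
  then show ?case using y Suc add_closed by blast
qed

text \<open>The first form yields differences of tensors in \<open>common_denominator\<close>; the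
  second extends \<open>nat_multiple\<close> to negative integers.\<close>

lemma negative:
  assumes "x \<in> carrier R"
  shows "\<exists>y\<in>carrier R. \<forall>s. frag_of (y, s) \<doteq> - frag_of (x, s) \<and> frag_of (y, s) \<doteq> frag_of (x, - s)"
proof -
  obtain y where y: "y \<in> carrier R" "\<forall>k\<in>J. m k y = - m k x" using ex_neg[OF assms] by blast
  have "y \<oplus> x = \<zero>"
    by (rule m_inj) (use assms y in \<open>auto simp: closed m_hom\<close>)
  have 1: "frag_of (y, s) \<doteq> - frag_of (x, s)" for s
  proof -
    have "frag_of (y, s) + frag_of (x, s) \<doteq> frag_of (y \<oplus> x, s)"
      using y assms by (intro cong_sym[OF cong_add_left])
    also have "\<dots> \<doteq> 0" unfolding \<open>y \<oplus> x = \<zero>\<close> by (rule cong_zero_left)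
    finally show ?thesis by (simp add: cong_def)
  qed
  have 2: "frag_of (x, - s) \<doteq> - frag_of (x, s)" for s
  proof -
    have "frag_of (x, - s) + frag_of (x, s) \<doteq> frag_of (x, - s + s)"
      using assms by (intro cong_sym[OF cong_add_right])
    also have "\<dots> \<doteq> 0" using cong_zero_right[OF assms] by simp
    finally show ?thesis by (simp add: cong_def)
  qed
  show ?thesis using y 1 cong_trans[OF 1 cong_sym[OF 2]] by blast
qed

lemma int_multiple:
  assumes "x \<in> carrier R"
  shows "\<exists>y\<in>carrier R. \<forall>s. frag_of (y, s) \<doteq> frag_of (x, of_int n * s)"
proof (cases "n \<ge> 0")
  case True
  then show ?thesis using nat_multiple[OF assms, of "nat n"] by simp
next
  case False
  obtain y where y: "y \<in> carrier R" "\<And>s. frag_of (y, s) \<doteq> frag_of (x, of_nat (nat (- n)) * s)"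
    using nat_multiple[OF assms] by blast
  obtain z where z: "z \<in> carrier R" "\<And>s. frag_of (z, s) \<doteq> frag_of (y, - s)"
    using negative[OF y(1)] by blast
  have "frag_of (z, s) \<doteq> frag_of (x, of_int n * s)" for s
    using cong_trans[OF z(2) y(2), of s] False by simp
  then show ?thesis using z by blast
qed

text \<open>Since integer factors move across the tensor sign, a sum of pure tensors collapses to a
  single one. Questions about tensors thereby become questions about one element of
  \<open>R\<close>, where \<open>m_inj\<close> applies.\<close>

lemma common_denominator:
  assumes "c \<in> carrier F"
  shows "\<exists>x\<in>carrier R. \<exists>N::int. N > 0 \<and> c \<doteq> frag_of (x, 1 / of_int N)"
  using assms
proof (induction rule: F_induct)
  case zero
  then show ?case using zero_closed cong_sym[OF cong_zero_left] by (intro bexI[of _ \<zero>] exI[of _ 1]) auto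
next
  case (frag a s)
  \<comment> \<open>With \<open>s = p / q\<close>, the numerator moves to the left factor and
    \<open>1 / q\<close> remains on the right.\<close>
  obtain p q where s: "quotient_of s = (p, q)" by (meson surj_pair)
  then have q: "q > 0" "s = of_int p * (1 / of_int q)"
    using quotient_of_denom_pos quotient_of_div by fastforce+
  obtain y where "y \<in> carrier R" "\<forall>s. frag_of (y, s) \<doteq> frag_of (a, of_int p * s)"
    using int_multiple[OF frag] by blast
  then show ?case using q cong_sym by blast
next
  case (diff c d)
  then obtain x y N M where x: "x \<in> carrier R" "N > 0" "c \<doteq> frag_of (x, 1 / of_int N)"
    and y: "y \<in> carrier R" "M > 0" "d \<doteq> frag_of (y, 1 / of_int M)" by blast
  obtain x' where x': "x' \<in> carrier R" "\<And>s. frag_of (x', s) \<doteq> frag_of (x, of_int M * s)"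
    using int_multiple[OF x(1)] by blast
  obtain y' where y': "y' \<in> carrier R" "\<And>s. frag_of (y', s) \<doteq> frag_of (y, of_int N * s)"
    using int_multiple[OF y(1)] by blast
  obtain z where z: "z \<in> carrier R" "\<And>s. frag_of (z, s) \<doteq> - frag_of (y', s)"
    using negative[OF y'(1)] by blast
  \<comment> \<open>The sum of \<open>x'\<close> and \<open>z\<close> stands for
    \<open>M x - N y\<close>, the numerator of \<open>x / N - y / M\<close> over the common
    denominator \<open>N * M\<close>.\<close>
  let ?s = "1 / of_int (N * M) :: rat"
  have "frag_of (x' \<oplus> z, ?s) \<doteq> frag_of (x', ?s) + frag_of (z, ?s)"
    using x' z by (intro cong_add_left)
  also have "\<dots> \<doteq> frag_of (x, of_int M * ?s) + - frag_of (y', ?s)"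
    using x' z by (intro cong_add)
  also have "\<dots> = frag_of (x, 1 / of_int N) - frag_of (y', ?s)" using y by simp
  also have "\<dots> \<doteq> frag_of (x, 1 / of_int N) - frag_of (y, of_int N * ?s)"
    using y' by (intro cong_diff cong_refl)
  also have "\<dots> = frag_of (x, 1 / of_int N) - frag_of (y, 1 / of_int M)" using x by simp
  also have "\<dots> \<doteq> c - d"
    using x y by (intro cong_diff) (auto intro: cong_sym)
  finally have "frag_of (x' \<oplus> z, ?s) \<doteq> c - d" .
  then show ?case
    using x y x' z cong_sym by (intro bexI[of _ "x' \<oplus> z"] exI[of _ "N * M"]) (auto simp: closed)
qed

text \<open>If all evaluations of \<open>c\<close> vanish, write \<open>c\<close> as
  \<open>x\<close> tensor \<open>1 / N\<close>. Each mark of \<open>x\<close> is then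
  \<open>N\<close> times zero, so \<open>x\<close> is zero. This is how joint injectivity survives
  the extension of scalars.\<close>

lemma I_eq_kernel: "I = {c \<in> carrier F. \<forall>k\<in>J. ev k c = 0}"
proof (intro equalityI subsetI)
  fix c assume "c \<in> {c \<in> carrier F. \<forall>k\<in>J. ev k c = 0}"
  then have c: "c \<in> carrier F" "\<And>k. k \<in> J \<Longrightarrow> ev k c = 0" by auto
  obtain x N where x: "x \<in> carrier R" "N > 0" "c \<doteq> frag_of (x, 1 / of_int N)"
    using common_denominator[OF c(1)] by blast
  have "x = \<zero>"
  proof (rule m_inj)
    fix k assume k: "k \<in> J"
    have "ev k (c - frag_of (x, 1 / of_int N)) = 0"
      using x(3) k ev_I unfolding cong_def by blast
    then show "m k x = m k \<zero>"
      using k c x by (simp add: ev_diff m_hom)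
  qed (use x closed in auto)
  then have "c \<doteq> 0" using x cong_zero_left cong_trans by blast
  then show "c \<in> I" by (simp add: cong_def)
qed (use ev_I I_subset in auto)

section \<open>The tensor product ring and its marks\<close>

abbreviation T where "T \<equiv> tensor_ring R Q"

lemma T_def: "T = F Quot I"
  by (simp add: tensor_ring_def I_def)

text \<open>By \<open>I_eq_kernel\<close> these fibres of the evaluations are the cosets of
  \<open>I\<close>; the form makes it evident that representatives are interchangeable.\<close>

definition coset where "coset c = {d \<in> carrier F. \<forall>k\<in>J. ev k d = ev k c}"

lemma rcos_I: "c \<in> carrier F \<Longrightarrow> I +>\<^bsub>F\<^esub> c = coset c"
proof -
  assume c: "c \<in> carrier F"
  have "d \<in> I +>\<^bsub>F\<^esub> c \<longleftrightarrow> d \<in> coset c" for d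
  proof -
    have "d \<in> I +>\<^bsub>F\<^esub> c \<longleftrightarrow> d - c \<in> I"
      by (auto simp: a_r_coset_def' F_simps intro!: bexI[of _ "d - c"])
    also have "\<dots> \<longleftrightarrow> d \<in> coset c"
      using c F_closed(2)[of "d - c" c] F_closed(3)[of d c]
      by (auto simp: I_eq_kernel coset_def ev_diff)
    finally show ?thesis .
  qed
  then show ?thesis by blast
qed

lemma T_carrier: "carrier T = coset ` carrier F"
proof -
  have "carrier T = (\<lambda>c. I +>\<^bsub>F\<^esub> c) ` carrier F"
    by (auto simp: T_def FactRing_def A_RCOSETS_def RCOSETS_def a_r_coset_def)
  then show ?thesis using rcos_I by simp
qed

lemma coset_cong: "(\<And>k. k \<in> J \<Longrightarrow> ev k c = ev k d) \<Longrightarrow> coset c = coset d"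
  by (auto simp: coset_def)

lemma coset_self: "c \<in> carrier F \<Longrightarrow> c \<in> coset c"
  by (simp add: coset_def)

lemma T_one: "\<one>\<^bsub>T\<^esub> = coset (frag_of (\<one>, 1))"
  by (simp add: T_def FactRing_def F_simps(4) rcos_I F_closed closed)

lemma T_zero: "\<zero>\<^bsub>T\<^esub> = coset 0"
  by (simp add: T_def FactRing_def I_eq_kernel coset_def)

lemma T_add:
  assumes "c \<in> carrier F" "d \<in> carrier F"
  shows "coset c \<oplus>\<^bsub>T\<^esub> coset d = coset (c + d)"
proof -
  have "coset c \<oplus>\<^bsub>T\<^esub> coset d = (\<Union>h\<in>coset c. \<Union>k\<in>coset d. {h + k})"
    by (simp add: T_def FactRing_def set_add_def set_mult_def F_simps)
  also have "\<dots> = coset (c + d)"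
  proof (intro equalityI subsetI)
    fix e assume "e \<in> coset (c + d)"
    then have e: "e - c \<in> coset d"
      using assms by (auto simp: coset_def ev_add ev_diff F_closed)
    show "e \<in> (\<Union>h\<in>coset c. \<Union>k\<in>coset d. {h + k})"
      using coset_self[OF assms(1)] e by (intro UN_I[of c] UN_I[of "e - c"]) auto
  qed (use assms in \<open>auto simp: coset_def ev_add F_closed\<close>)
  finally show ?thesis .
qed

text \<open>The quotient product is a union over all representatives. The evaluations are
  multiplicative, so every pair of representatives contributes the same fibre.\<close>

lemma T_mult:
  assumes "c \<in> carrier F" "d \<in> carrier F"
  shows "coset c \<otimes>\<^bsub>T\<^esub> coset d = coset (c \<otimes>\<^bsub>F\<^esub> d)"
proof -
  have "I +>\<^bsub>F\<^esub> (h \<otimes>\<^bsub>F\<^esub> k) = coset (c \<otimes>\<^bsub>F\<^esub> d)" if "h \<in> coset c" "k \<in> coset d" for h k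
  proof -
    have hk: "h \<in> carrier F" "k \<in> carrier F" using that by (auto simp: coset_def)
    then have "I +>\<^bsub>F\<^esub> (h \<otimes>\<^bsub>F\<^esub> k) = coset (h \<otimes>\<^bsub>F\<^esub> k)" by (simp add: rcos_I F_mult)
    also have "\<dots> = coset (c \<otimes>\<^bsub>F\<^esub> d)"
      by (rule coset_cong) (use that hk assms in \<open>auto simp: F_mult coset_def\<close>)
    finally show ?thesis .
  qed
  moreover have "c \<in> coset c" "d \<in> coset d" using assms by (auto intro: coset_self)
  ultimately have "(\<Union>h\<in>coset c. \<Union>k\<in>coset d. I +>\<^bsub>F\<^esub> (h \<otimes>\<^bsub>F\<^esub> k)) = coset (c \<otimes>\<^bsub>F\<^esub> d)"
    by blast
  then show ?thesis
    by (simp add: T_def FactRing_def rcoset_mult_def)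
qed

lemma the_elem_ev_coset: "c \<in> carrier F \<Longrightarrow> k \<in> J \<Longrightarrow> the_elem (ev k ` coset c) = ev k c"
proof -
  assume "c \<in> carrier F" "k \<in> J"
  then have "ev k ` coset c = {ev k c}" using coset_self[of c] by (auto simp: coset_def)
  then show ?thesis by simp
qed

lemma tensor_embedding: "joint_ring_embedding T J (\<lambda>k Z. the_elem (ev k ` Z))"
proof unfold_locales
  fix x assume "x \<in> carrier T"
  then obtain c where c: "x = coset c" "c \<in> carrier F" by (auto simp: T_carrier)
  show "\<exists>y\<in>carrier T. \<forall>k\<in>J. the_elem (ev k ` y) = - the_elem (ev k ` x)"
    by (rule bexI[of _ "coset (- c)"]) (use c in \<open>auto simp: T_carrier the_elem_ev_coset F_closed ev_minus\<close>)
next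
  fix x y
  assume "x \<in> carrier T" "y \<in> carrier T"
    and eq: "\<And>k. k \<in> J \<Longrightarrow> the_elem (ev k ` x) = the_elem (ev k ` y)"
  then obtain c d where "x = coset c" "c \<in> carrier F" "y = coset d" "d \<in> carrier F"
    by (auto simp: T_carrier)
  then show "x = y" using eq by (auto intro!: coset_cong simp: the_elem_ev_coset)
qed (auto simp: T_carrier T_add T_mult T_zero T_one the_elem_ev_coset F_mult F_closed closed m_hom ev_add)

text \<open>Carries conjugation invariance on to the tensor product, as
  \<open>the_elem_diff_cong\<close> does for the completion.\<close>

lemma the_elem_ev_cong:
  assumes "Z \<in> carrier T" "k \<in> J" "k' \<in> J" "\<And>x. x \<in> carrier R \<Longrightarrow> m k x = m k' x"
  shows "the_elem (ev k ` Z) = the_elem (ev k' ` Z)"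
proof -
  obtain c where c: "Z = coset c" "c \<in> carrier F" using assms(1) by (auto simp: T_carrier)
  then have "fst p \<in> carrier R" if "p \<in> Poly_Mapping.keys c" for p
    using that by (auto simp: F_simps)
  then have "ev k c = ev k' c"
    unfolding ev_def by (intro sum.cong) (auto simp: assms(4))
  then show ?thesis using c assms(2,3) by (simp add: the_elem_ev_coset)
qed

lemma ex_tensor_frag:
  "a \<in> carrier R \<Longrightarrow> \<exists>Z\<in>carrier T. \<forall>k\<in>J. the_elem (ev k ` Z) = of_int (m k a) * s"
  by (rule bexI[of _ "coset (frag_of (a, s))"]) (auto simp: T_carrier the_elem_ev_coset F_closed)

end

section \<open>Finite G-sets\<close>

context group
begin

text \<open>Replaces the homomorphism into \<open>BijGroup E\<close> by pointwise axioms. Backwards,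
  each group element acts bijectively because its inverse undoes it, and extensionality makes
  pointwise equal composites equal as functions.\<close>

lemma finite_gset_iff:
  "finite_gset G (E, \<phi>) \<longleftrightarrow> finite E \<and> (\<forall>g\<in>carrier G. \<phi> g \<in> extensional E) \<and>
     (\<forall>g\<in>carrier G. \<forall>x\<in>E. \<phi> g x \<in> E) \<and> (\<forall>x\<in>E. \<phi> \<one> x = x) \<and>
     (\<forall>g\<in>carrier G. \<forall>h\<in>carrier G. \<forall>x\<in>E. \<phi> (g \<otimes> h) x = \<phi> g (\<phi> h x))"
  (is "?L \<longleftrightarrow> ?R")
proof
  assume ?L
  then interpret group_action G E \<phi> by (simp add: finite_gset_def)
  show ?R
  proof (intro conjI ballI)
    show "finite E" using \<open>?L\<close> by (simp add: finite_gset_def)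
    show "\<phi> g \<in> extensional E" if "g \<in> carrier G" for g using bij_prop0[OF that] by (simp add: Bij_def)
    show "\<phi> \<one> x = x" if "x \<in> E" for x using that by (simp flip: id_eq_one)
  qed (use element_image composition_rule in blast)+
next
  assume r: ?R
  have bij: "\<phi> g \<in> Bij E" if g: "g \<in> carrier G" for g
  proof -
    have "bij_betw (\<phi> g) E E"
    proof (rule bij_betw_byWitness[where f' = "\<phi> (inv g)"])
      show "\<forall>x\<in>E. \<phi> (inv g) (\<phi> g x) = x" "\<forall>x\<in>E. \<phi> g (\<phi> (inv g) x) = x"
        using r g by (metis inv_closed l_inv, metis inv_closed r_inv)
    qed (use r g in auto)
    then show ?thesis using r g by (simp add: Bij_def)
  qed
  have "group_action G E \<phi>"
    unfolding group_action_def group_hom_def group_hom_axioms_def hom_def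
  proof (intro conjI CollectI ballI)
    fix g h assume gh: "g \<in> carrier G" "h \<in> carrier G"
    then have "\<phi> (g \<otimes> h) = compose E (\<phi> g) (\<phi> h)"
      using r by (intro extensionalityI[of _ E]) (auto simp: compose_def)
    then show "\<phi> (g \<otimes> h) = \<phi> g \<otimes>\<^bsub>BijGroup E\<^esub> \<phi> h"
      using gh bij by (simp add: BijGroup_def)
  next
    show "\<phi> \<in> carrier G \<rightarrow> carrier (BijGroup E)" using bij by (auto simp: BijGroup_def)
  qed (simp_all add: group_BijGroup is_group)
  then show ?L using r by (simp add: finite_gset_def)
qed

lemma finite_gsetI:
  assumes "finite E" "\<And>g. g \<in> carrier G \<Longrightarrow> \<phi> g \<in> extensional E"
    "\<And>g x. g \<in> carrier G \<Longrightarrow> x \<in> E \<Longrightarrow> \<phi> g x \<in> E" "\<And>x. x \<in> E \<Longrightarrow> \<phi> \<one> x = x"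
    "\<And>g h x. g \<in> carrier G \<Longrightarrow> h \<in> carrier G \<Longrightarrow> x \<in> E \<Longrightarrow> \<phi> (g \<otimes> h) x = \<phi> g (\<phi> h x)"
  shows "finite_gset G (E, \<phi>)"
  using assms by (simp add: finite_gset_iff)

lemma
  assumes "finite_gset G (E, \<phi>)"
  shows gset_finite: "finite E"
    and gset_closed: "g \<in> carrier G \<Longrightarrow> x \<in> E \<Longrightarrow> \<phi> g x \<in> E"
    and gset_one: "x \<in> E \<Longrightarrow> \<phi> \<one> x = x"
    and gset_mult: "g \<in> carrier G \<Longrightarrow> h \<in> carrier G \<Longrightarrow> x \<in> E \<Longrightarrow> \<phi> (g \<otimes> h) x = \<phi> g (\<phi> h x)"
  using assms by (auto simp: finite_gset_iff)

lemma gset_inv: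
  assumes "finite_gset G (E, \<phi>)" "g \<in> carrier G" "x \<in> E"
  shows "\<phi> (inv g) (\<phi> g x) = x" "\<phi> g (\<phi> (inv g) x) = x"
  using assms gset_mult[OF assms(1), of "inv g" g x] gset_mult[OF assms(1), of g "inv g" x]
  by (simp_all add: gset_one)

lemma gset_iso_iff:
  "gset_iso G (E, \<phi>) (F, \<psi>) \<longleftrightarrow>
     (\<exists>f. bij_betw f E F \<and> (\<forall>g \<in> carrier G. \<forall>x \<in> E. f (\<phi> g x) = \<psi> g (f x)))"
  by (simp add: gset_iso_def)

lemma gset_iso_refl: "gset_iso G S S"
  by (cases S) (auto simp: gset_iso_iff intro!: exI[of _ id])

lemma gset_iso_sym:
  assumes "finite_gset G S" "gset_iso G S T"
  shows "gset_iso G T S"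
proof -
  obtain E \<phi> F \<psi> where S: "S = (E, \<phi>)" "T = (F, \<psi>)" by (meson surj_pair)
  then obtain f where f: "bij_betw f E F" "\<And>g x. g \<in> carrier G \<Longrightarrow> x \<in> E \<Longrightarrow> f (\<phi> g x) = \<psi> g (f x)"
    using assms by (auto simp: gset_iso_iff)
  have "inv_into E f (\<psi> g y) = \<phi> g (inv_into E f y)" if "g \<in> carrier G" "y \<in> F" for g y
  proof -
    obtain x where x: "x \<in> E" "y = f x" using f(1) \<open>y \<in> F\<close> by (auto simp: bij_betw_def)
    have "\<psi> g y = f (\<phi> g x)" using f(2) x \<open>g \<in> carrier G\<close> by simp
    moreover have "\<phi> g x \<in> E" using assms(1) S x \<open>g \<in> carrier G\<close> by (auto intro: gset_closed)
    ultimately show ?thesis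
      using x by (simp add: bij_betw_inv_into_left[OF f(1)])
  qed
  then show ?thesis
    using bij_betw_inv_into[OF f(1)] by (auto simp: S gset_iso_iff)
qed

lemma gset_iso_trans:
  assumes "gset_iso G S T" "gset_iso G T U"
  shows "gset_iso G S U"
proof -
  obtain E \<phi> F \<psi> D \<theta> where S: "S = (E, \<phi>)" "T = (F, \<psi>)" "U = (D, \<theta>)" by (meson surj_pair)
  then obtain f h where f: "bij_betw f E F" "\<And>g x. g \<in> carrier G \<Longrightarrow> x \<in> E \<Longrightarrow> f (\<phi> g x) = \<psi> g (f x)"
    and h: "bij_betw h F D" "\<And>g x. g \<in> carrier G \<Longrightarrow> x \<in> F \<Longrightarrow> h (\<psi> g x) = \<theta> g (h x)"
    using assms by (auto simp: gset_iso_iff)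
  then have "bij_betw (h \<circ> f) E D" "\<And>g x. g \<in> carrier G \<Longrightarrow> x \<in> E \<Longrightarrow> (h \<circ> f) (\<phi> g x) = \<theta> g ((h \<circ> f) x)"
    by (auto intro: bij_betw_trans simp: bij_betw_apply)
  then show ?thesis by (auto simp only: S gset_iso_iff)
qed

lemma stabilizer_iso:
  assumes "finite_gset G (E, \<phi>)" "bij_betw f E F"
    "\<And>g x. g \<in> carrier G \<Longrightarrow> x \<in> E \<Longrightarrow> f (\<phi> g x) = \<psi> g (f x)" "x \<in> E"
  shows "stabilizer G \<psi> (f x) = stabilizer G \<phi> x"
proof -
  have "\<psi> g (f x) = f x \<longleftrightarrow> \<phi> g x = x" if "g \<in> carrier G" for g
  proof -
    have "\<psi> g (f x) = f (\<phi> g x)" using assms(3,4) that by simp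
    then show ?thesis
      using assms(4) gset_closed[OF assms(1) that assms(4)] inj_on_eq_iff[OF bij_betw_imp_inj_on[OF assms(2)]]
      by simp
  qed
  then show ?thesis by (auto simp: stabilizer_def)
qed

text \<open>Transport of structure along an enumeration of the points. A class contains only G-sets
  on natural numbers, so this makes the class of a finite G-set over any type nonempty.\<close>

lemma ex_nat_gset:
  assumes "finite_gset G S"
  shows "\<exists>T :: ('a, nat) gset. finite_gset G T \<and> gset_iso G S T"
proof -
  obtain E \<phi> where S: "S = (E, \<phi>)" by (meson surj_pair)
  note gs = assms[unfolded S]
  obtain f :: "_ \<Rightarrow> nat" and n where f: "bij_betw f E {..<n}"
    using gset_finite[OF gs] by (metis ex_bij_betw_finite_nat atLeast0LessThan)
  define \<psi> where "\<psi> g = restrict (\<lambda>y. f (\<phi> g (inv_into E f y))) {..<n}" for g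
  have i: "inv_into E f y \<in> E" if "y < n" for y
    using f that by (metis bij_betw_apply bij_betw_inv_into lessThan_iff)
  have c: "f x < n" if "x \<in> E" for x using f that bij_betw_apply by fastforce
  have l: "inv_into E f (f x) = x" if "x \<in> E" for x using f that by (rule bij_betw_inv_into_left)
  have r: "f (inv_into E f y) = y" if "y < n" for y using f that by (simp add: bij_betw_inv_into_right)
  have "finite_gset G ({..<n}, \<psi>)"
    by (rule finite_gsetI)
      (auto simp: \<psi>_def i c l r gset_one[OF gs] gset_mult[OF gs] gset_closed[OF gs])
  moreover have "gset_iso G S ({..<n}, \<psi>)"
    unfolding S gset_iso_iff using f by (intro exI[of _ f]) (auto simp: \<psi>_def c l)
  ultimately show ?thesis by blast
qed

lemma gset_class_cong:
  assumes "finite_gset G S" "gset_iso G S T"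
  shows "gset_class G S = gset_class G T"
proof -
  have "gset_iso G S U \<longleftrightarrow> gset_iso G T U" for U :: "('a, nat) gset"
    using gset_iso_trans[OF assms(2)] gset_iso_trans[OF gset_iso_sym[OF assms]] by blast
  then show ?thesis by (simp add: gset_class_def)
qed

lemma gset_class_self: "finite_gset G T \<Longrightarrow> T \<in> gset_class G T"
  by (simp add: gset_class_def gset_iso_refl)

lemma gset_class_eq_iff:
  fixes S T :: "('a, nat) gset"
  assumes "finite_gset G S" "finite_gset G T"
  shows "gset_class G S = gset_class G T \<longleftrightarrow> gset_iso G S T"
proof
  assume "gset_class G S = gset_class G T"
  then have "T \<in> gset_class G S" using gset_class_self[OF assms(2)] by simp
  then show "gset_iso G S T" by (simp add: gset_class_def)
qed (rule gset_class_cong[OF assms(1)])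

lemma finite_gset_union:
  assumes "finite_gset G (E, \<phi>)" "finite_gset G (F, \<psi>)"
  shows "finite_gset G (gset_union (E, \<phi>) (F, \<psi>))"
  unfolding gset_union_def prod.case
  using assms by (intro finite_gsetI) (auto simp: gset_finite gset_closed gset_one gset_mult)

lemma finite_gset_prod:
  assumes "finite_gset G (E, \<phi>)" "finite_gset G (F, \<psi>)"
  shows "finite_gset G (gset_prod (E, \<phi>) (F, \<psi>))"
  unfolding gset_prod_def prod.case
  using assms by (intro finite_gsetI) (auto simp: gset_finite gset_closed gset_one gset_mult)

lemma finite_gset_trivial: "finite E \<Longrightarrow> finite_gset G (trivial_gset E)"
  unfolding trivial_gset_def by (intro finite_gsetI) auto

lemma gset_union_cong:
  assumes "gset_iso G S S'" "gset_iso G T T'"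
  shows "gset_iso G (gset_union S T) (gset_union S' T')"
proof -
  obtain E \<phi> F \<psi> E' \<phi>' F' \<psi>' where S: "S = (E, \<phi>)" "T = (F, \<psi>)" "S' = (E', \<phi>')" "T' = (F', \<psi>')"
    by (meson surj_pair)
  obtain f h where f: "bij_betw f E E'" "\<And>g x. g \<in> carrier G \<Longrightarrow> x \<in> E \<Longrightarrow> f (\<phi> g x) = \<phi>' g (f x)"
    and h: "bij_betw h F F'" "\<And>g x. g \<in> carrier G \<Longrightarrow> x \<in> F \<Longrightarrow> h (\<psi> g x) = \<psi>' g (h x)"
    using assms by (auto simp: S gset_iso_iff)
  have "bij_betw (map_sum f h) (Sum_Type.Plus E F) (Sum_Type.Plus E' F')"
  proof (rule bij_betw_imageI)
    show "inj_on (map_sum f h) (Sum_Type.Plus E F)"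
      using f(1) h(1) by (intro inj_onI) (auto simp: bij_betw_def inj_on_eq_iff)
    have "map_sum f h ` Sum_Type.Plus E F = Sum_Type.Plus (f ` E) (h ` F)"
      by (simp add: Plus_def image_Un image_image)
    then show "map_sum f h ` Sum_Type.Plus E F = Sum_Type.Plus E' F'"
      using f(1) h(1) by (simp add: bij_betw_def)
  qed
  then show ?thesis
    unfolding S gset_union_def prod.case gset_iso_iff using f h
    by (intro exI[of _ "map_sum f h"]) (auto simp: bij_betw_apply)
qed

lemma gset_prod_cong:
  assumes "gset_iso G S S'" "gset_iso G T T'"
  shows "gset_iso G (gset_prod S T) (gset_prod S' T')"
proof -
  obtain E \<phi> F \<psi> E' \<phi>' F' \<psi>' where S: "S = (E, \<phi>)" "T = (F, \<psi>)" "S' = (E', \<phi>')" "T' = (F', \<psi>')"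
    by (meson surj_pair)
  obtain f h where f: "bij_betw f E E'" "\<And>g x. g \<in> carrier G \<Longrightarrow> x \<in> E \<Longrightarrow> f (\<phi> g x) = \<phi>' g (f x)"
    and h: "bij_betw h F F'" "\<And>g x. g \<in> carrier G \<Longrightarrow> x \<in> F \<Longrightarrow> h (\<psi> g x) = \<psi>' g (h x)"
    using assms by (auto simp: S gset_iso_iff)
  have "bij_betw (map_prod f h) (E \<times> F) (E' \<times> F')"
    using f(1) h(1) by (rule bij_betw_map_prod)
  then show ?thesis
    unfolding S gset_prod_def prod.case gset_iso_iff using f h
    by (intro exI[of _ "map_prod f h"]) (auto simp: bij_betw_apply)
qed

section \<open>Fixed points and their numbers\<close>

lemma fixed_points_iff:
  "K \<subseteq> carrier G \<Longrightarrow> x \<in> fixed_points K (E, \<phi>) \<longleftrightarrow> x \<in> E \<and> K \<subseteq> stabilizer G \<phi> x"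
  by (auto simp: fixed_points_def stabilizer_def)

lemma finite_fixed_points: "finite_gset G S \<Longrightarrow> finite (fixed_points K S)"
  by (cases S) (auto simp: fixed_points_def dest: gset_finite)

lemma card_fixed_points_iso:
  assumes "finite_gset G S" "gset_iso G S T" "K \<subseteq> carrier G"
  shows "card (fixed_points K S) = card (fixed_points K T)"
proof -
  obtain E \<phi> F \<psi> where S: "S = (E, \<phi>)" "T = (F, \<psi>)" by (meson surj_pair)
  then obtain f where f: "bij_betw f E F" "\<And>g x. g \<in> carrier G \<Longrightarrow> x \<in> E \<Longrightarrow> f (\<phi> g x) = \<psi> g (f x)"
    using assms by (auto simp: gset_iso_iff)
  have st: "stabilizer G \<psi> (f x) = stabilizer G \<phi> x" if "x \<in> E" for x
    using assms(1) S f that by (intro stabilizer_iso) auto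
  have "f ` fixed_points K S = fixed_points K T"
    using f(1) st by (auto simp: S fixed_points_iff[OF assms(3)] bij_betw_def intro!: imageI)
  moreover have "inj_on f (fixed_points K S)"
    using f(1) by (auto simp: S fixed_points_def bij_betw_def intro: inj_on_subset)
  ultimately show ?thesis by (metis card_image)
qed

lemma card_fixed_points_union:
  assumes "finite_gset G S" "finite_gset G T"
  shows "card (fixed_points K (gset_union S T)) = card (fixed_points K S) + card (fixed_points K T)"
proof -
  obtain E \<phi> F \<psi> where S: "S = (E, \<phi>)" "T = (F, \<psi>)" by (meson surj_pair)
  have "fixed_points K (gset_union S T) = Sum_Type.Plus (fixed_points K S) (fixed_points K T)"
    by (auto simp: S gset_union_def fixed_points_def)
  then show ?thesis using assms by (simp add: card_Plus finite_fixed_points)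
qed

lemma card_fixed_points_prod:
  "card (fixed_points K (gset_prod S T)) = card (fixed_points K S) * card (fixed_points K T)"
proof -
  obtain E \<phi> F \<psi> where S: "S = (E, \<phi>)" "T = (F, \<psi>)" by (meson surj_pair)
  have "fixed_points K (gset_prod S T) = fixed_points K S \<times> fixed_points K T"
    by (auto simp: S gset_prod_def fixed_points_def)
  then show ?thesis by (simp add: card_cartesian_product)
qed

lemma fixed_points_trivial: "fixed_points K (trivial_gset E) = E"
  by (auto simp: trivial_gset_def fixed_points_def)

section \<open>Conjugate subgroups and stabilizers\<close>

lemma inv_cancel:
  assumes "g \<in> carrier G" "h \<in> carrier G"
  shows "inv g \<otimes> (g \<otimes> h) = h" "g \<otimes> (inv g \<otimes> h) = h"
  using assms by (simp_all flip: m_assoc)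

lemma mem_conj_subgroup:
  assumes "H \<subseteq> carrier G" "g \<in> carrier G"
  shows "x \<in> conj_subgroup G g H \<longleftrightarrow> x \<in> carrier G \<and> inv g \<otimes> x \<otimes> g \<in> H"
proof
  assume "x \<in> conj_subgroup G g H"
  then obtain h where "h \<in> H" "x = g \<otimes> h \<otimes> inv g"
    by (auto simp: conj_subgroup_def l_coset_def r_coset_def)
  then show "x \<in> carrier G \<and> inv g \<otimes> x \<otimes> g \<in> H"
    using assms by (auto simp: m_assoc subset_iff inv_cancel)
next
  assume x: "x \<in> carrier G \<and> inv g \<otimes> x \<otimes> g \<in> H"
  then have "x = g \<otimes> (inv g \<otimes> x \<otimes> g) \<otimes> inv g"
    using assms by (simp add: m_assoc inv_cancel)
  then show "x \<in> conj_subgroup G g H"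
    using x unfolding conj_subgroup_def l_coset_def r_coset_def by blast
qed

lemma conj_subgroup_subset: "H \<subseteq> carrier G \<Longrightarrow> g \<in> carrier G \<Longrightarrow> conj_subgroup G g H \<subseteq> carrier G"
  by (auto simp: mem_conj_subgroup)

lemma conj_subgroup_carrier: "g \<in> carrier G \<Longrightarrow> conj_subgroup G g (carrier G) = carrier G"
  by (auto simp: mem_conj_subgroup)

lemma conj_subgroup_one: "H \<subseteq> carrier G \<Longrightarrow> conj_subgroup G \<one> H = H"
  by (auto simp: mem_conj_subgroup subset_iff)

lemma conj_subgroup_mult:
  assumes "H \<subseteq> carrier G" "g \<in> carrier G" "h \<in> carrier G"
  shows "conj_subgroup G g (conj_subgroup G h H) = conj_subgroup G (g \<otimes> h) H"
  using assms by (auto simp: mem_conj_subgroup conj_subgroup_subset inv_mult_group m_assoc)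

lemma conj_subgroup_inv:
  assumes "H \<subseteq> carrier G" "g \<in> carrier G"
  shows "conj_subgroup G (inv g) (conj_subgroup G g H) = H"
  using assms by (simp add: conj_subgroup_mult conj_subgroup_one)

lemma card_conj_subgroup:
  assumes "H \<subseteq> carrier G" "g \<in> carrier G"
  shows "card (conj_subgroup G g H) = card H"
proof -
  have "conj_subgroup G g H = (\<lambda>h. g \<otimes> h \<otimes> inv g) ` H"
    by (auto simp: conj_subgroup_def l_coset_def r_coset_def)
  moreover have "inj_on (\<lambda>h. g \<otimes> h \<otimes> inv g) H"
    using assms by (intro inj_onI) (auto simp: subset_iff)
  ultimately show ?thesis by (simp add: card_image)
qed

text \<open>An element \<open>h\<close> fixes the translate of \<open>x\<close> by \<open>g\<close>
  exactly when the product of \<open>inv g\<close>, \<open>h\<close> and \<open>g\<close> fixes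
  \<open>x\<close>.\<close>

lemma stabilizer_translate:
  assumes "finite_gset G (E, \<phi>)" "x \<in> E" "g \<in> carrier G"
  shows "stabilizer G \<phi> (\<phi> g x) = conj_subgroup G g (stabilizer G \<phi> x)"
proof -
  have "\<phi> h (\<phi> g x) = \<phi> g x \<longleftrightarrow> \<phi> (inv g \<otimes> h \<otimes> g) x = x" if "h \<in> carrier G" for h
    using assms that
    by (simp add: gset_mult[OF assms(1)] gset_closed[OF assms(1)] m_assoc)
      (metis gset_closed gset_inv inv_closed)
  then show ?thesis
    using assms by (auto simp: mem_conj_subgroup stabilizer_def)
qed

text \<open>The action of \<open>g\<close> maps points fixed by \<open>K\<close> to points fixed by
  the conjugate, and the action of \<open>inv g\<close> maps them back. Hence marks are class
  functions.\<close>

lemma card_fixed_points_conj: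
  assumes "finite_gset G S" "K \<subseteq> carrier G" "g \<in> carrier G"
  shows "card (fixed_points (conj_subgroup G g K) S) = card (fixed_points K S)"
proof -
  obtain E \<phi> where S: "S = (E, \<phi>)" by (meson surj_pair)
  note gs = assms(1)[unfolded S]
  have tr: "\<phi> h x \<in> fixed_points (conj_subgroup G h L) S"
    if x: "x \<in> fixed_points L S" and L: "L \<subseteq> carrier G" and h: "h \<in> carrier G" for x h L
  proof -
    have x': "x \<in> E" "L \<subseteq> stabilizer G \<phi> x" using x L by (auto simp: S fixed_points_iff)
    then have "conj_subgroup G h L \<subseteq> conj_subgroup G h (stabilizer G \<phi> x)"
      by (auto simp: conj_subgroup_def l_coset_def r_coset_def)
    then show ?thesis
      using x' L h by (simp add: S fixed_points_iff conj_subgroup_subset stabilizer_translate[OF gs] gset_closed[OF gs])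
  qed
  have "bij_betw (\<phi> g) (fixed_points K S) (fixed_points (conj_subgroup G g K) S)"
  proof (rule bij_betw_byWitness[where f' = "\<phi> (inv g)"])
    show "\<phi> (inv g) ` fixed_points (conj_subgroup G g K) S \<subseteq> fixed_points K S"
      using tr[of _ "conj_subgroup G g K" "inv g"] assms
      by (auto simp: conj_subgroup_inv conj_subgroup_subset)
  qed (use assms tr in \<open>auto simp: S fixed_points_def gset_inv[OF gs]\<close>)
  then show ?thesis by (metis bij_betw_same_card)
qed

section \<open>Coset sets, orbits and their stabilizers\<close>

lemma l_coset_fixed_iff:
  assumes "subgroup K G" "a \<in> carrier G" "g \<in> carrier G"
  shows "g <# (a <# K) = a <# K \<longleftrightarrow> g \<in> conj_subgroup G a K"
proof -
  note K = subgroup.subset[OF assms(1)]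
  have ga: "g <# (a <# K) = (g \<otimes> a) <# K" using K assms by (simp add: lcos_m_assoc)
  show ?thesis
  proof
    assume "g <# (a <# K) = a <# K"
    then have "(g \<otimes> a) \<otimes> \<one> \<in> a <# K"
      unfolding ga using subgroup.one_closed[OF assms(1)] by (auto simp: l_coset_def)
    then obtain k where "k \<in> K" "g \<otimes> a = a \<otimes> k" using assms by (auto simp: l_coset_def)
    then show "g \<in> conj_subgroup G a K"
      using assms K by (simp add: mem_conj_subgroup m_assoc subset_iff inv_cancel)
  next
    assume "g \<in> conj_subgroup G a K"
    then have k: "inv a \<otimes> g \<otimes> a \<in> K" using assms K by (auto simp: mem_conj_subgroup)
    have "g \<otimes> a = a \<otimes> (inv a \<otimes> g \<otimes> a)" using assms by (simp add: m_assoc inv_cancel)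
    then have "(g \<otimes> a) <# K = a <# ((inv a \<otimes> g \<otimes> a) <# K)"
      using K assms by (simp add: lcos_m_assoc)
    also have "(inv a \<otimes> g \<otimes> a) <# K = K" using k assms by (intro coset_join3) auto
    finally show "g <# (a <# K) = a <# K" using ga by simp
  qed
qed

lemma mem_lcosets: "C \<in> lcosets K \<longleftrightarrow> (\<exists>a\<in>carrier G. C = a <# K)"
  by (auto simp: LCOSETS_def)

lemma finite_coset_gset:
  assumes "finite (carrier G)" "subgroup K G"
  shows "finite_gset G (coset_gset G K)"
  unfolding coset_gset_def
proof (rule finite_gsetI)
  note K = subgroup.subset[OF assms(2)]
  show "finite (lcosets K)" using assms by (simp add: LCOSETS_def)
  show cl: "(\<lambda>C\<in>lcosets K. g <# C) x \<in> lcosets K" if "g \<in> carrier G" "x \<in> lcosets K" for g x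
    using that K by (auto simp: mem_lcosets lcos_m_assoc)
  show "(\<lambda>C\<in>lcosets K. \<one> <# C) x = x" if "x \<in> lcosets K" for x
    using that K by (auto simp: mem_lcosets lcos_m_assoc)
  show "(\<lambda>C\<in>lcosets K. g \<otimes> h <# C) x = (\<lambda>C\<in>lcosets K. g <# C) ((\<lambda>C\<in>lcosets K. h <# C) x)"
    if "g \<in> carrier G" "h \<in> carrier G" "x \<in> lcosets K" for g h x
    using that K cl[of h x] by (auto simp: mem_lcosets lcos_m_assoc m_assoc)
qed auto

lemma stabilizer_coset:
  assumes "subgroup K G" "a \<in> carrier G"
  shows "stabilizer G (snd (coset_gset G K)) (a <# K) = conj_subgroup G a K"
  using assms l_coset_fixed_iff[OF assms] conj_subgroup_subset[of K a] subgroup.subset[OF assms(1)]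
  by (auto simp: stabilizer_def coset_gset_def mem_lcosets)

text \<open>The stabilizer of the coset \<open>a H\<close> is the conjugate of \<open>H\<close> by
  \<open>a\<close>, so a fixed coset amounts to a conjugate of \<open>H\<close> containing
  \<open>K\<close>. This decides which marks of coset sets vanish.\<close>

lemma fixed_points_coset_nonempty:
  assumes "subgroup H G" "K \<subseteq> carrier G"
  shows "fixed_points K (coset_gset G H) \<noteq> {} \<longleftrightarrow> (\<exists>a\<in>carrier G. K \<subseteq> conj_subgroup G a H)"
proof -
  have "fixed_points K (coset_gset G H) \<noteq> {} \<longleftrightarrow>
      (\<exists>a\<in>carrier G. K \<subseteq> stabilizer G (snd (coset_gset G H)) (a <# H))"
    using fixed_points_iff[OF assms(2), of _ "lcosets H" "snd (coset_gset G H)"]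
    by (simp add: coset_gset_def mem_lcosets ex_in_conv[symmetric] del: ex_in_conv) blast
  then show ?thesis using stabilizer_coset[OF assms(1)] by simp
qed

text \<open>A point \<open>y\<close> of the orbit goes to its transporter, the set of all group
  elements taking \<open>x\<close> to \<open>y\<close>, which is a left coset of the stabilizer. No
  representative has to be chosen.\<close>

lemma orbit_iso_coset_gset:
  assumes "finite_gset G (E, \<phi>)" "x \<in> E"
  shows "gset_iso G (orbit G \<phi> x, \<lambda>g. restrict (\<phi> g) (orbit G \<phi> x)) (coset_gset G (stabilizer G \<phi> x))"
proof -
  note gs = assms(1)
  let ?H = "stabilizer G \<phi> x"
  define f where "f y = {g \<in> carrier G. \<phi> g x = y}" for y
  have eq: "f (\<phi> h y) = h <# f y" if "h \<in> carrier G" "y \<in> E" for h y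
  proof (intro equalityI subsetI)
    fix k assume k: "k \<in> f (\<phi> h y)"
    then have "inv h \<otimes> k \<in> f y"
      using that assms(2) by (auto simp: f_def gset_mult[OF gs] gset_inv[OF gs])
    moreover have "k = h \<otimes> (inv h \<otimes> k)" using k that by (simp add: f_def inv_cancel)
    ultimately show "k \<in> h <# f y" unfolding l_coset_def by blast
  qed (use that assms(2) in \<open>auto simp: f_def l_coset_def gset_mult[OF gs]\<close>)
  have fx: "f x = ?H" by (simp add: f_def stabilizer_def)
  have fh: "f (\<phi> h x) = h <# ?H" if "h \<in> carrier G" for h using eq[OF that assms(2)] fx by simp
  have sub: "orbit G \<phi> x \<subseteq> E" using assms(2) by (auto simp: orbit_def gset_closed[OF gs])
  have "inj_on f (orbit G \<phi> x)"
    by (rule inj_onI) (auto simp: f_def orbit_def)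
  moreover have "f ` orbit G \<phi> x = lcosets ?H"
    by (force simp: orbit_def mem_lcosets fh image_iff)
  ultimately show ?thesis
    unfolding coset_gset_def gset_iso_iff using sub eq
    by (intro exI[of _ f]) (auto simp: bij_betw_def)
qed

subsection \<open>Burnside's theorem\<close>

text \<open>Orbits are removed one at a time below; working with subsets of a fixed G-set keeps one
  and the same action throughout, where smaller G-sets would need restricted ones.\<close>

definition invariant_subset :: "('a, 'x) gset \<Rightarrow> 'x set \<Rightarrow> bool" where
  "invariant_subset S A \<longleftrightarrow> A \<subseteq> fst S \<and> (\<forall>g\<in>carrier G. \<forall>x\<in>A. snd S g x \<in> A)"

lemma invariant_subset_orbit:
  assumes "finite_gset G (E, \<phi>)" "invariant_subset (E, \<phi>) A" "x \<in> A"
  shows "orbit G \<phi> x \<subseteq> A" "x \<in> orbit G \<phi> x" "invariant_subset (E, \<phi>) (orbit G \<phi> x)"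
    "invariant_subset (E, \<phi>) (A - orbit G \<phi> x)"
proof -
  note gs = assms(1)
  have x: "x \<in> E" using assms by (auto simp: invariant_subset_def)
  show sub: "orbit G \<phi> x \<subseteq> A" using assms by (auto simp: invariant_subset_def orbit_def)
  show "x \<in> orbit G \<phi> x"
    unfolding orbit_def using gset_one[OF gs x] by force
  have inv: "\<phi> g y \<in> orbit G \<phi> x" if "g \<in> carrier G" "y \<in> orbit G \<phi> x" for g y
    using that x gset_mult[OF gs, symmetric] by (auto simp: orbit_def)
  then show "invariant_subset (E, \<phi>) (orbit G \<phi> x)"
    using sub assms(2) by (auto simp: invariant_subset_def)
  have "y \<in> orbit G \<phi> x" if "g \<in> carrier G" "y \<in> E" "\<phi> g y \<in> orbit G \<phi> x" for g y
    using inv[of "inv g", OF _ that(3)] that gset_inv[OF gs] by simp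
  then show "invariant_subset (E, \<phi>) (A - orbit G \<phi> x)"
    using assms(2) by (auto simp: invariant_subset_def)
qed

text \<open>Both orbits are isomorphic to the coset set of the common stabilizer.\<close>

lemma orbits_iso:
  assumes "finite_gset G (E, \<phi>)" "finite_gset G (F, \<psi>)" "x \<in> E" "y \<in> F"
    "stabilizer G \<phi> x = stabilizer G \<psi> y"
  shows "\<exists>f. bij_betw f (orbit G \<phi> x) (orbit G \<psi> y) \<and>
    (\<forall>g\<in>carrier G. \<forall>z\<in>orbit G \<phi> x. f (\<phi> g z) = \<psi> g (f z))"
proof -
  \<comment> \<open>The isomorphism of the second orbit with its coset set has to be inverted, and
    \<open>gset_iso_sym\<close> asks for a finite G-set.\<close>
  have fin: "finite_gset G (orbit G \<psi> y, \<lambda>g. restrict (\<psi> g) (orbit G \<psi> y))"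
  proof (rule finite_gsetI)
    show "finite (orbit G \<psi> y)"
      using gset_finite[OF assms(2)] by (rule rev_finite_subset)
        (use assms(4) in \<open>auto simp: orbit_def gset_closed[OF assms(2)]\<close>)
    show cl: "restrict (\<psi> g) (orbit G \<psi> y) z \<in> orbit G \<psi> y"
      if "g \<in> carrier G" "z \<in> orbit G \<psi> y" for g z
      using that assms(4) gset_mult[OF assms(2), symmetric] by (auto simp: orbit_def)
    show "restrict (\<psi> \<one>) (orbit G \<psi> y) z = z" if "z \<in> orbit G \<psi> y" for z
      using that assms(4) by (auto simp: orbit_def gset_one[OF assms(2)] gset_closed[OF assms(2)])
    show "restrict (\<psi> (g \<otimes> h)) (orbit G \<psi> y) z = restrict (\<psi> g) (orbit G \<psi> y) (restrict (\<psi> h) (orbit G \<psi> y) z)"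
      if "g \<in> carrier G" "h \<in> carrier G" "z \<in> orbit G \<psi> y" for g h z
    proof -
      have "z \<in> F" using that(3) assms(4) by (auto simp: orbit_def gset_closed[OF assms(2)])
      then show ?thesis using that cl[of h z] by (simp add: gset_mult[OF assms(2)])
    qed
  qed auto
  have "gset_iso G (orbit G \<phi> x, \<lambda>g. restrict (\<phi> g) (orbit G \<phi> x))
     (orbit G \<psi> y, \<lambda>g. restrict (\<psi> g) (orbit G \<psi> y))"
    using orbit_iso_coset_gset[OF assms(1,3)] gset_iso_sym[OF fin orbit_iso_coset_gset[OF assms(2,4)]]
    by (auto simp: assms(5) intro: gset_iso_trans)
  then show ?thesis
    unfolding gset_iso_iff by (auto simp: bij_betw_apply)
qed

lemma card_Diff_Collect:
  assumes "finite C" "D \<subseteq> C"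
  shows "card {z \<in> C - D. P z} = card {z \<in> C. P z} - card {z \<in> D. P z}"
proof -
  have "{z \<in> C - D. P z} = {z \<in> C. P z} - {z \<in> D. P z}" by auto
  moreover have "finite {z \<in> D. P z}" using assms by (auto intro: finite_subset)
  moreover have "{z \<in> D. P z} \<subseteq> {z \<in> C. P z}" using assms by auto
  ultimately show ?thesis by (simp add: card_Diff_subset)
qed

text \<open>A point whose stabilizer \<open>H\<close> is maximal on one side forces, by comparing the numbers of
  \<open>H\<close>-fixed points, a point with stabilizer exactly \<open>H\<close> on the other side; the two orbits are
  isomorphic and can be removed.\<close>

lemma invariant_subsets_iso:
  assumes "finite (carrier G)" "finite_gset G (E, \<phi>)" "finite_gset G (F, \<psi>)"
    "invariant_subset (E, \<phi>) A" "invariant_subset (F, \<psi>) B"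
    "\<And>x. x \<in> A \<Longrightarrow> stabilizer G \<phi> x \<in> \<K>" "\<And>y. y \<in> B \<Longrightarrow> stabilizer G \<psi> y \<in> \<K>"
    "\<And>K. K \<in> \<K> \<Longrightarrow> K \<subseteq> carrier G"
    "\<And>K. K \<in> \<K> \<Longrightarrow> card {x \<in> A. K \<subseteq> stabilizer G \<phi> x} = card {y \<in> B. K \<subseteq> stabilizer G \<psi> y}"
  shows "\<exists>f. bij_betw f A B \<and> (\<forall>g\<in>carrier G. \<forall>x\<in>A. f (\<phi> g x) = \<psi> g (f x))"
  using assms(4-7,9)
proof (induction "card A" arbitrary: A B rule: less_induct)
  case (less A B)
  have finA: "finite A" and finB: "finite B"
    using less.prems(1,2) gset_finite[OF assms(2)] gset_finite[OF assms(3)]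
    by (auto simp: invariant_subset_def intro: finite_subset)
  let ?M = "stabilizer G \<phi> ` A \<union> stabilizer G \<psi> ` B"
  show ?case
  proof (cases "?M = {}")
    case True
    then show ?thesis by (auto simp: bij_betw_def)
  next
    case False
    \<comment> \<open>Choose a stabilizer of largest cardinality on either side; all of them being
      finite, it is also maximal for inclusion.\<close>
    have "finite ?M" using finA finB by simp
    then have "Max (card ` ?M) \<in> card ` ?M"
      using False by (intro Max_in) (simp_all only: finite_imageI image_is_empty not_False_eq_True)
    then obtain H where Hmax: "Max (card ` ?M) = card H" and H1: "H \<in> ?M" by (rule imageE)
    have H2: "card L \<le> card H" if "L \<in> ?M" for L
    proof -
      have "card L \<le> Max (card ` ?M)"
        by (rule Max_ge[OF finite_imageI[OF \<open>finite ?M\<close>] imageI[OF that]])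
      also note Hmax
      finally show ?thesis .
    qed
    note H = H1 H2
    have HK: "H \<in> \<K>" using H(1) less.prems(3,4) by auto
    have max: "L = H" if "L \<in> ?M" "H \<subseteq> L" for L
    proof -
      have "L \<in> \<K>" using that(1) less.prems(3,4) by auto
      then have "finite L" by (rule finite_subset[OF assms(8) assms(1)])
      from card_seteq[OF this that(2) H(2)[OF that(1)]] show ?thesis by (rule sym)
    qed
    have "\<exists>x\<in>A. \<exists>y\<in>B. stabilizer G \<phi> x = H \<and> stabilizer G \<psi> y = H"
    proof -
      have "{x \<in> A. H \<subseteq> stabilizer G \<phi> x} \<noteq> {} \<or> {y \<in> B. H \<subseteq> stabilizer G \<psi> y} \<noteq> {}"
        using H(1) by auto
      moreover have "card {x \<in> A. H \<subseteq> stabilizer G \<phi> x} = card {y \<in> B. H \<subseteq> stabilizer G \<psi> y}"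
        using less.prems(5) HK by blast
      moreover have "finite {x \<in> A. H \<subseteq> stabilizer G \<phi> x}" "finite {y \<in> B. H \<subseteq> stabilizer G \<psi> y}"
        using finA finB by simp_all
      ultimately have "{x \<in> A. H \<subseteq> stabilizer G \<phi> x} \<noteq> {} \<and> {y \<in> B. H \<subseteq> stabilizer G \<psi> y} \<noteq> {}"
        using card_eq_0_iff[of "{x \<in> A. H \<subseteq> stabilizer G \<phi> x}"]
          card_eq_0_iff[of "{y \<in> B. H \<subseteq> stabilizer G \<psi> y}"] by argo
      then obtain x y where "x \<in> A" "H \<subseteq> stabilizer G \<phi> x" "y \<in> B" "H \<subseteq> stabilizer G \<psi> y" by blast
      then show ?thesis using max by blast
    qed
    then obtain x y where x: "x \<in> A" "stabilizer G \<phi> x = H" and y: "y \<in> B" "stabilizer G \<psi> y = H"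
      by blast
    let ?O = "orbit G \<phi> x" and ?P = "orbit G \<psi> y"
    note Ox = invariant_subset_orbit[OF assms(2) less.prems(1) x(1)]
    note Py = invariant_subset_orbit[OF assms(3) less.prems(2) y(1)]
    have xE: "x \<in> E" and yF: "y \<in> F" using x y less.prems by (auto simp: invariant_subset_def)
    obtain f where f: "bij_betw f ?O ?P" "\<And>g z. g \<in> carrier G \<Longrightarrow> z \<in> ?O \<Longrightarrow> f (\<phi> g z) = \<psi> g (f z)"
      using orbits_iso[OF assms(2,3) xE yF] x y by auto
    have inj: "f z = f z' \<longleftrightarrow> z = z'" if "z \<in> ?O" "z' \<in> ?O" for z z'
      using f(1) that by (auto simp: bij_betw_def inj_on_eq_iff)
    have st: "stabilizer G \<psi> (f z) = stabilizer G \<phi> z" if "z \<in> ?O" for z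
    proof -
      have "\<psi> g (f z) = f z \<longleftrightarrow> \<phi> g z = z" if "g \<in> carrier G" for g
      proof -
        have "\<psi> g (f z) = f (\<phi> g z)" using f(2) that \<open>z \<in> ?O\<close> by simp
        moreover have "\<phi> g z \<in> ?O" using Ox(3) that \<open>z \<in> ?O\<close> by (simp add: invariant_subset_def)
        ultimately show ?thesis using inj \<open>z \<in> ?O\<close> by simp
      qed
      then show ?thesis by (auto simp: stabilizer_def)
    qed
    \<comment> \<open>Since \<open>f\<close> preserves stabilizers, both orbits contribute equally
      to every count, and the hypothesis on counts survives their removal.\<close>
    have cardO: "card {z \<in> ?O. K \<subseteq> stabilizer G \<phi> z} = card {z \<in> ?P. K \<subseteq> stabilizer G \<psi> z}" for K
    proof -
      have "f ` {z \<in> ?O. K \<subseteq> stabilizer G \<phi> z} = {z \<in> ?P. K \<subseteq> stabilizer G \<psi> z}"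
        unfolding bij_betw_imp_surj_on[OF f(1), symmetric] using st by blast
      then have "bij_betw f {z \<in> ?O. K \<subseteq> stabilizer G \<phi> z} {z \<in> ?P. K \<subseteq> stabilizer G \<psi> z}"
        by (rule bij_betw_subset[OF f(1), rotated]) blast
      then show ?thesis by (rule bij_betw_same_card)
    qed
    have "\<exists>h. bij_betw h (A - ?O) (B - ?P) \<and> (\<forall>g\<in>carrier G. \<forall>x\<in>A - ?O. h (\<phi> g x) = \<psi> g (h x))"
    proof (rule less.hyps)
      show "card (A - ?O) < card A"
        using finA Ox(2) x(1) by (intro psubset_card_mono) auto
      fix K assume K: "K \<in> \<K>"
      show "card {z \<in> A - ?O. K \<subseteq> stabilizer G \<phi> z} = card {z \<in> B - ?P. K \<subseteq> stabilizer G \<psi> z}"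
        using less.prems(5)[OF K] cardO[of K] card_Diff_Collect[OF finA Ox(1)] card_Diff_Collect[OF finB Py(1)] by simp
    qed (use Ox Py less.prems in auto)
    then obtain h where h: "bij_betw h (A - ?O) (B - ?P)"
      "\<And>g z. g \<in> carrier G \<Longrightarrow> z \<in> A - ?O \<Longrightarrow> h (\<phi> g z) = \<psi> g (h z)" by blast
    let ?k = "\<lambda>z. if z \<in> ?O then f z else h z"
    have "bij_betw ?k (?O \<union> (A - ?O)) (?P \<union> (B - ?P))"
      using f(1) h(1) by (rule bij_betw_disjoint_Un) auto
    then have "bij_betw ?k A B" using Ox(1) Py(1) by (simp add: Un_absorb1)
    moreover have "?k (\<phi> g z) = \<psi> g (?k z)" if "g \<in> carrier G" "z \<in> A" for g z
      using that f(2) h(2) Ox(3,4) by (auto simp: invariant_subset_def)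
    ultimately show ?thesis by blast
  qed
qed

end

section \<open>The Burnside ring of a transfer system\<close>

locale finite_group_transfer = group G
  for G :: "('a, 'b) monoid_scheme" (structure) +
  fixes Tr :: "('a set \<times> 'a set) set"
  assumes finite_carrier: "finite (carrier G)"
    and transfer: "transfer_system G Tr"
begin

abbreviation J :: "'a set set" where "J \<equiv> transfer_subgroups G Tr"
abbreviation conj :: "'a \<Rightarrow> 'a set \<Rightarrow> 'a set" where "conj \<equiv> conj_subgroup G"

lemma transfer_order:
  "Tr \<subseteq> {H. subgroup H G} \<times> {H. subgroup H G}" "refl_on {H. subgroup H G} Tr" "trans Tr"
  using transfer by (auto simp: transfer_system_def partial_order_on_def preorder_on_def)

lemma J_subgroup: "K \<in> J \<Longrightarrow> subgroup K G"
  using transfer_order(1) by (auto simp: transfer_subgroups_def)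

lemma J_subset: "K \<in> J \<Longrightarrow> K \<subseteq> carrier G"
  using J_subgroup subgroup.subset by blast

lemma J_carrier: "carrier G \<in> J"
  using transfer_order(2) subgroup_self by (auto simp: transfer_subgroups_def refl_on_def)

text \<open>Restricting \<open>K -> G\<close> along the subgroup \<open>H\<close> gives a relation
  to \<open>H\<close>, which composes with \<open>H -> G\<close> by transitivity.\<close>

lemma J_Int:
  assumes "H \<in> J" "K \<in> J"
  shows "K \<inter> H \<in> J"
proof -
  have "(K, carrier G) \<in> Tr" using assms(2) by (simp add: transfer_subgroups_def)
  then have "(K \<inter> H, H) \<in> Tr"
    using transfer J_subgroup[OF assms(1)] J_subset[OF assms(1)] unfolding transfer_system_def by blast
  moreover have "(H, carrier G) \<in> Tr" using assms(1) by (simp add: transfer_subgroups_def)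
  ultimately show ?thesis using transfer_order(3) by (auto simp: transfer_subgroups_def dest: transD)
qed

lemma J_conj:
  assumes "K \<in> J" "g \<in> carrier G"
  shows "conj g K \<in> J"
proof -
  have "(K, carrier G) \<in> Tr" using assms(1) by (simp add: transfer_subgroups_def)
  then have "(conj g K, conj g (carrier G)) \<in> Tr"
    using transfer assms(2) unfolding transfer_system_def by blast
  then show ?thesis using assms(2) by (simp add: conj_subgroup_carrier transfer_subgroups_def)
qed

lemma finite_J: "finite J"
  using finite_carrier J_subset by (intro finite_subset[of J "Pow (carrier G)"]) auto

subsection \<open>Admissible sets\<close>

text \<open>An isomorphism from an orbit to \<open>G/K\<close> takes \<open>x\<close> to some coset
  \<open>a K\<close>, so the stabilizer of \<open>x\<close> is a conjugate of \<open>K\<close> and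
  lies in \<open>J\<close>; conversely, an orbit is the coset set of a stabilizer. The pointwise
  form is easily checked on unions and products.\<close>

lemma admissible_iff:
  "admissible_gset G Tr (E, \<phi>) \<longleftrightarrow>
     finite_gset G (E, \<phi>) \<and> (\<forall>x\<in>E. stabilizer G \<phi> x \<in> J)" (is "?L \<longleftrightarrow> ?R")
proof
  assume ?L
  then have gs: "finite_gset G (E, \<phi>)"
    and orb: "\<And>A. A \<in> orbits G E \<phi> \<Longrightarrow>
      \<exists>K \<in> J. gset_iso G (A, \<lambda>g. restrict (\<phi> g) A) (coset_gset G K)"
    by (auto simp: admissible_gset_def)
  have "stabilizer G \<phi> x \<in> J" if x: "x \<in> E" for x
  proof -
    let ?O = "orbit G \<phi> x"
    have inv: "invariant_subset (E, \<phi>) E" using gset_closed[OF gs] by (simp add: invariant_subset_def)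
    note O = invariant_subset_orbit[OF gs inv x]
    have "?O \<in> orbits G E \<phi>" using x by (auto simp: orbits_def)
    then obtain K where K: "K \<in> J" "gset_iso G (?O, \<lambda>g. restrict (\<phi> g) ?O) (coset_gset G K)"
      using orb by blast
    then obtain f where f: "bij_betw f ?O (lcosets K)"
      "\<And>g z. g \<in> carrier G \<Longrightarrow> z \<in> ?O \<Longrightarrow> f (restrict (\<phi> g) ?O z) = snd (coset_gset G K) g (f z)"
      by (auto simp: coset_gset_def gset_iso_iff)
    have fx: "f x \<in> lcosets K" using f(1) O(2) by (rule bij_betw_apply)
    then obtain a where a: "a \<in> carrier G" "f x = a <# K" by (auto simp: mem_lcosets)
    have "\<phi> g x = x \<longleftrightarrow> snd (coset_gset G K) g (f x) = f x" if g: "g \<in> carrier G" for g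
    proof -
      have "\<phi> g x \<in> ?O" using g by (auto simp: orbit_def)
      then have "f (\<phi> g x) = f x \<longleftrightarrow> \<phi> g x = x"
        using O(2) inj_on_eq_iff[OF bij_betw_imp_inj_on[OF f(1)]] by simp
      then show ?thesis using f(2)[OF g O(2)] O(2) by simp
    qed
    then have "stabilizer G \<phi> x = stabilizer G (snd (coset_gset G K)) (f x)"
      by (auto simp: stabilizer_def)
    also have "\<dots> = conj a K" unfolding a(2) using J_subgroup[OF K(1)] a(1) by (rule stabilizer_coset)
    finally show ?thesis using J_conj[OF K(1) a(1)] by simp
  qed
  then show ?R using gs by blast
next
  assume r: ?R
  then show ?L
    using orbit_iso_coset_gset[of E \<phi>] by (auto simp: admissible_gset_def orbits_def)
qed

lemma admissible_finite: "admissible_gset G Tr S \<Longrightarrow> finite_gset G S"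
  by (cases S) (simp add: admissible_iff)

lemma admissible_iso:
  assumes "admissible_gset G Tr S" "gset_iso G S T" "finite_gset G T"
  shows "admissible_gset G Tr T"
proof -
  obtain E \<phi> F \<psi> where S: "S = (E, \<phi>)" "T = (F, \<psi>)" by (meson surj_pair)
  then obtain f where f: "bij_betw f E F" "\<And>g x. g \<in> carrier G \<Longrightarrow> x \<in> E \<Longrightarrow> f (\<phi> g x) = \<psi> g (f x)"
    using assms by (auto simp: gset_iso_iff)
  have "stabilizer G \<psi> y \<in> J" if "y \<in> F" for y
  proof -
    obtain x where "x \<in> E" "y = f x" using f(1) \<open>y \<in> F\<close> by (auto simp: bij_betw_def)
    then show ?thesis
      using assms(1) stabilizer_iso[of E \<phi> f F \<psi> x] f by (simp add: S admissible_iff)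
  qed
  then show ?thesis using assms(3) by (simp add: S admissible_iff)
qed

lemma admissible_union:
  assumes "admissible_gset G Tr S" "admissible_gset G Tr T"
  shows "admissible_gset G Tr (gset_union S T)"
proof -
  obtain E \<phi> F \<psi> where S: "S = (E, \<phi>)" "T = (F, \<psi>)" by (meson surj_pair)
  have "finite_gset G (gset_union S T)"
    using assms by (simp add: S admissible_iff finite_gset_union)
  moreover have
    "stabilizer G (\<lambda>g. restrict (map_sum (\<phi> g) (\<psi> g)) (Sum_Type.Plus E F)) (Inl x) = stabilizer G \<phi> x"
    if "x \<in> E" for x using that by (auto simp: stabilizer_def)
  moreover have
    "stabilizer G (\<lambda>g. restrict (map_sum (\<phi> g) (\<psi> g)) (Sum_Type.Plus E F)) (Inr x) = stabilizer G \<psi> x"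
    if "x \<in> F" for x using that by (auto simp: stabilizer_def)
  ultimately show ?thesis
    using assms by (auto simp: S gset_union_def admissible_iff)
qed

text \<open>The stabilizer of a pair is an intersection of stabilizers, so \<open>J_Int\<close>
  applies.\<close>

lemma admissible_prod:
  assumes "admissible_gset G Tr S" "admissible_gset G Tr T"
  shows "admissible_gset G Tr (gset_prod S T)"
proof -
  obtain E \<phi> F \<psi> where S: "S = (E, \<phi>)" "T = (F, \<psi>)" by (meson surj_pair)
  have "finite_gset G (gset_prod S T)"
    using assms by (simp add: S admissible_iff finite_gset_prod)
  moreover have "stabilizer G (\<lambda>g. restrict (map_prod (\<phi> g) (\<psi> g)) (E \<times> F)) (x, y) =
      stabilizer G \<phi> x \<inter> stabilizer G \<psi> y"
    if "x \<in> E" "y \<in> F" for x y using that by (auto simp: stabilizer_def)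
  ultimately show ?thesis
    using assms J_Int by (auto simp: S gset_prod_def admissible_iff)
qed

lemma admissible_trivial: "finite E \<Longrightarrow> admissible_gset G Tr (trivial_gset E)"
proof -
  have "stabilizer G (\<lambda>g. restrict id E) x = carrier G" if "x \<in> E" for x
    using that by (auto simp: stabilizer_def)
  then show "finite E \<Longrightarrow> ?thesis"
    using finite_gset_trivial[of E] J_carrier by (simp add: trivial_gset_def admissible_iff)
qed

lemma admissible_coset:
  assumes "K \<in> J"
  shows "admissible_gset G Tr (coset_gset G K)"
proof -
  have "stabilizer G (snd (coset_gset G K)) C \<in> J" if C: "C \<in> lcosets K" for C
    using that assms by (auto simp: mem_lcosets stabilizer_coset J_subgroup J_conj)
  then show ?thesis
    using finite_coset_gset[OF finite_carrier J_subgroup[OF assms]]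
    by (simp add: coset_gset_def admissible_iff)
qed

text \<open>Marks on the subgroups in \<open>J\<close> suffice to separate admissible sets, since all stabilizers
  lie in \<open>J\<close>.\<close>

lemma admissible_isoI:
  assumes "admissible_gset G Tr S" "admissible_gset G Tr T"
    "\<And>K. K \<in> J \<Longrightarrow> card (fixed_points K S) = card (fixed_points K T)"
  shows "gset_iso G S T"
proof -
  obtain E \<phi> F \<psi> where S: "S = (E, \<phi>)" "T = (F, \<psi>)" by (meson surj_pair)
  note gs = assms(1,2)[THEN admissible_finite, unfolded S]
  have fpS: "fixed_points K S = {x \<in> E. K \<subseteq> stabilizer G \<phi> x}"
    and fpT: "fixed_points K T = {x \<in> F. K \<subseteq> stabilizer G \<psi> x}" if "K \<in> J" for K
    using fixed_points_iff[OF J_subset[OF that], of _ E \<phi>] fixed_points_iff[OF J_subset[OF that], of _ F \<psi>]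
    unfolding S by blast+
  have "\<exists>f. bij_betw f E F \<and> (\<forall>g\<in>carrier G. \<forall>x\<in>E. f (\<phi> g x) = \<psi> g (f x))"
  proof (rule invariant_subsets_iso[OF finite_carrier gs, where \<K> = J])
    show "invariant_subset (E, \<phi>) E" "invariant_subset (F, \<psi>) F"
      using gset_closed[OF gs(1)] gset_closed[OF gs(2)] by (simp_all add: invariant_subset_def)
    show "stabilizer G \<phi> x \<in> J" if "x \<in> E" for x using assms(1) that by (simp add: S admissible_iff)
    show "stabilizer G \<psi> x \<in> J" if "x \<in> F" for x using assms(2) that by (simp add: S admissible_iff)
    show "card {x \<in> E. K \<subseteq> stabilizer G \<phi> x} = card {y \<in> F. K \<subseteq> stabilizer G \<psi> y}" if "K \<in> J" for K
      using assms(3)[OF that] by (simp only: fpS[OF that] fpT[OF that])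
  qed (rule J_subset)
  then show ?thesis by (simp add: S gset_iso_iff)
qed

section \<open>The semiring of isomorphism classes and its completion\<close>

abbreviation S :: "('a, nat) gset set ring" where "S \<equiv> gset_semiring G Tr"

lemma S_carrierI:
  assumes "admissible_gset G Tr T"
  shows "gset_class G T \<in> carrier S"
proof -
  obtain U :: "('a, nat) gset" where U: "finite_gset G U" "gset_iso G T U"
    using ex_nat_gset[OF admissible_finite[OF assms]] by blast
  then have "gset_class G T = gset_class G U" "admissible_gset G Tr U"
    using admissible_finite[OF assms] gset_class_cong admissible_iso assms by blast+
  then show ?thesis unfolding gset_semiring_def by (cases U) auto
qed

lemma S_carrierE:
  assumes "A \<in> carrier S"
  obtains T :: "('a, nat) gset" where "A = gset_class G T" "admissible_gset G Tr T"
  using assms by (auto simp: gset_semiring_def)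

lemma mem_gset_classD:
  assumes "U \<in> gset_class G T" "finite_gset G T"
  shows "finite_gset G U" "gset_iso G T U" "gset_iso G U T"
  using assms gset_iso_sym[of T U] by (simp_all add: gset_class_def)

text \<open>The copy of \<open>T\<close> on natural numbers shows that the class is nonempty, so
  \<open>the_elem\<close> is applied to a singleton; \<open>T\<close> itself may live over any
  type.\<close>

lemma class_mark_class:
  assumes "finite_gset G T" "K \<subseteq> carrier G"
  shows "class_mark K (gset_class G T) = card (fixed_points K T)"
proof -
  obtain U :: "('a, nat) gset" where U: "finite_gset G U" "gset_iso G T U"
    using ex_nat_gset[OF assms(1)] by blast
  have "(\<lambda>T. card (fixed_points K T)) ` gset_class G T = {card (fixed_points K T)}"
  proof (intro equalityI subsetI)
    fix n assume "n \<in> {card (fixed_points K T)}"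
    then show "n \<in> (\<lambda>T. card (fixed_points K T)) ` gset_class G T"
      using card_fixed_points_iso[OF assms(1) U(2) assms(2)] U
      by (intro image_eqI[of _ _ U]) (simp_all add: gset_class_def)
  qed (auto simp: gset_class_def card_fixed_points_iso[OF assms(1) _ assms(2)])
  then show ?thesis by (simp add: class_mark_def)
qed

lemma UN_UN_constant:
  assumes "a \<in> A" "b \<in> B" "\<And>x y. x \<in> A \<Longrightarrow> y \<in> B \<Longrightarrow> f x y = C"
  shows "(\<Union>x\<in>A. \<Union>y\<in>B. f x y) = C"
  using assms by auto

lemma class_add:
  fixes T U :: "('a, nat) gset"
  assumes "finite_gset G T" "finite_gset G U"
  shows "gset_class G T \<oplus>\<^bsub>S\<^esub> gset_class G U = gset_class G (gset_union T U)"
proof -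
  have *: "gset_class G (gset_union T' U') = gset_class G (gset_union T U)"
    if "T' \<in> gset_class G T" "U' \<in> gset_class G U" for T' U'
  proof (rule gset_class_cong)
    show "finite_gset G (gset_union T' U')"
      using mem_gset_classD(1)[OF that(1) assms(1)] mem_gset_classD(1)[OF that(2) assms(2)]
        finite_gset_union by (cases T', cases U') simp
    show "gset_iso G (gset_union T' U') (gset_union T U)"
      using mem_gset_classD(3)[OF that(1) assms(1)] mem_gset_classD(3)[OF that(2) assms(2)]
      by (rule gset_union_cong)
  qed
  have "(\<Union>T'\<in>gset_class G T. \<Union>U'\<in>gset_class G U. gset_class G (gset_union T' U')) = gset_class G (gset_union T U)"
    using gset_class_self[OF assms(1)] gset_class_self[OF assms(2)] * by (rule UN_UN_constant)
  then show ?thesis by (simp add: gset_semiring_def)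
qed

lemma class_mult:
  fixes T U :: "('a, nat) gset"
  assumes "finite_gset G T" "finite_gset G U"
  shows "gset_class G T \<otimes>\<^bsub>S\<^esub> gset_class G U = gset_class G (gset_prod T U)"
proof -
  have *: "gset_class G (gset_prod T' U') = gset_class G (gset_prod T U)"
    if "T' \<in> gset_class G T" "U' \<in> gset_class G U" for T' U'
  proof (rule gset_class_cong)
    show "finite_gset G (gset_prod T' U')"
      using mem_gset_classD(1)[OF that(1) assms(1)] mem_gset_classD(1)[OF that(2) assms(2)]
        finite_gset_prod by (cases T', cases U') simp
    show "gset_iso G (gset_prod T' U') (gset_prod T U)"
      using mem_gset_classD(3)[OF that(1) assms(1)] mem_gset_classD(3)[OF that(2) assms(2)]
      by (rule gset_prod_cong)
  qed
  have "(\<Union>T'\<in>gset_class G T. \<Union>U'\<in>gset_class G U. gset_class G (gset_prod T' U')) = gset_class G (gset_prod T U)"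
    using gset_class_self[OF assms(1)] gset_class_self[OF assms(2)] * by (rule UN_UN_constant)
  then show ?thesis by (simp add: gset_semiring_def)
qed

lemma S_zero: "\<zero>\<^bsub>S\<^esub> = gset_class G (trivial_gset ({} :: unit set))"
  and S_one: "\<one>\<^bsub>S\<^esub> = gset_class G (trivial_gset {()})"
  by (simp_all add: gset_semiring_def)

text \<open>Joint injectivity is Burnside's theorem in the form \<open>admissible_isoI\<close>; the
  other conditions are closure properties and counts of fixed points.\<close>

sublocale semiring: joint_nat_embedding S J class_mark
proof
  show "\<zero>\<^bsub>S\<^esub> \<in> carrier S" "\<one>\<^bsub>S\<^esub> \<in> carrier S"
    unfolding S_zero S_one by (intro S_carrierI admissible_trivial; simp)+
  fix x y assume "x \<in> carrier S" "y \<in> carrier S"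
  then obtain T U :: "('a, nat) gset" where x: "x = gset_class G T" "admissible_gset G Tr T"
    and y: "y = gset_class G U" "admissible_gset G Tr U" by (auto elim!: S_carrierE)
  note fin = x(2)[THEN admissible_finite] y(2)[THEN admissible_finite]
  have finU: "finite_gset G (gset_union T U)" and finP: "finite_gset G (gset_prod T U)"
    using x y admissible_union admissible_prod admissible_finite by blast+
  show "x \<oplus>\<^bsub>S\<^esub> y \<in> carrier S" "x \<otimes>\<^bsub>S\<^esub> y \<in> carrier S"
    unfolding x y class_add[OF fin] class_mult[OF fin]
    using x(2) y(2) by (blast intro: S_carrierI admissible_union admissible_prod)+
  show "class_mark k (x \<oplus>\<^bsub>S\<^esub> y) = class_mark k x + class_mark k y" if "k \<in> J" for k
    unfolding x y class_add[OF fin] using J_subset[OF that] fin finU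
    by (simp add: class_mark_class card_fixed_points_union)
  show "class_mark k (x \<otimes>\<^bsub>S\<^esub> y) = class_mark k x * class_mark k y" if "k \<in> J" for k
    unfolding x y class_mult[OF fin] using J_subset[OF that] fin finP
    by (simp add: class_mark_class card_fixed_points_prod)
  show "x = y" if "\<And>k. k \<in> J \<Longrightarrow> class_mark k x = class_mark k y"
  proof -
    have "gset_iso G T U"
      using that x y fin J_subset by (intro admissible_isoI) (simp_all add: class_mark_class)
    then show ?thesis unfolding x y using fin by (simp add: gset_class_eq_iff)
  qed
qed (simp_all add: S_zero S_one class_mark_class J_subset finite_gset_trivial fixed_points_trivial)

lemma class_mark_conj:
  assumes "x \<in> carrier S" "K \<in> J" "g \<in> carrier G"
  shows "class_mark (conj g K) x = class_mark K x"
  using assms(1)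
proof (rule S_carrierE)
  fix T :: "('a, nat) gset" assume "x = gset_class G T" "admissible_gset G Tr T"
  then show ?thesis
    using J_subset[OF assms(2)] assms(3) conj_subgroup_subset
    by (simp add: class_mark_class card_fixed_points_conj admissible_finite)
qed

sublocale burnside: joint_int_embedding "burnside_ring G Tr" J burnside_mark
proof -
  have "burnside_mark = (\<lambda>(k :: 'a set) C. the_elem ((\<lambda>(a, b). int (class_mark k a) - int (class_mark k b)) ` C))"
    by (intro ext) (simp add: burnside_mark_def)
  then show "joint_int_embedding (burnside_ring G Tr) J burnside_mark"
    unfolding burnside_ring_def joint_int_embedding_def using semiring.groth_embedding by (simp only:)
qed

abbreviation B where "B \<equiv> rat_burnside_ring G Tr"

lemma mark_map_eq: "K \<in> J \<Longrightarrow> mark_map G Tr Z K = the_elem (burnside.ev K ` Z)"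
  by (simp add: mark_map_def burnside.ev_def)

sublocale rational: joint_ring_embedding B J "\<lambda>K Z. mark_map G Tr Z K"
  unfolding rat_burnside_ring_def
  by (rule joint_ring_embedding_cong[OF burnside.tensor_embedding mark_map_eq])

text \<open>\<open>K\<close> and its conjugate are both indices in \<open>J\<close> with equal marks
  on the semiring; the two congruence lemmas lift this equality through the completion and the
  tensor product.\<close>

lemma mark_map_conj:
  assumes "Z \<in> carrier B" "K \<in> J" "g \<in> carrier G"
  shows "mark_map G Tr Z (conj g K) = mark_map G Tr Z K"
proof -
  note KJ = assms(2) J_conj[OF assms(2,3)]
  have "burnside_mark (conj g K) C = burnside_mark K C" if "C \<in> carrier (burnside_ring G Tr)" for C
    unfolding burnside_mark_def
    using semiring.the_elem_diff_cong[OF that[unfolded burnside_ring_def] KJ(2,1)] class_mark_conj assms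
    by simp
  then show ?thesis
    using burnside.the_elem_ev_cong[OF _ KJ(2,1)] assms(1)
    by (simp add: mark_map_eq KJ rat_burnside_ring_def)
qed

subsection \<open>Surjectivity of the mark homomorphism\<close>

text \<open>Only values on \<open>J\<close> count and \<open>f\<close> need not be extensional, so
  sums and products can be written pointwise without restriction.\<close>

definition realizable :: "('a set \<Rightarrow> rat) \<Rightarrow> bool" where
  "realizable f \<longleftrightarrow> (\<exists>Z\<in>carrier B. \<forall>K\<in>J. mark_map G Tr Z K = f K)"

lemma realizable_add: "realizable f \<Longrightarrow> realizable h \<Longrightarrow> realizable (\<lambda>K. f K + h K)"
  unfolding realizable_def using rational.add_closed rational.m_add by metis

lemma realizable_mult: "realizable f \<Longrightarrow> realizable h \<Longrightarrow> realizable (\<lambda>K. f K * h K)"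
  unfolding realizable_def using rational.mult_closed rational.m_mult by metis

text \<open>Realized by the pure tensor of \<open>C\<close> and \<open>q\<close>; taking
  \<open>C\<close> to be the unit gives the rational constants.\<close>

lemma realizable_mark:
  assumes "C \<in> carrier (burnside_ring G Tr)"
  shows "realizable (\<lambda>K. of_int (burnside_mark K C) * q)"
  using burnside.ex_tensor_frag[OF assms, of q]
  by (auto simp: realizable_def rat_burnside_ring_def mark_map_eq)

lemma realizable_const: "realizable (\<lambda>K. q)"
  using realizable_mark[OF burnside.one_closed, of q] burnside.m_one by (simp add: realizable_def)

lemma realizable_coset:
  assumes "H \<in> J"
  shows "realizable (\<lambda>K. of_nat (card (fixed_points K (coset_gset G H))))"
proof -
  let ?x = "gset_class G (coset_gset G H)" and ?C = "semiring.cls (gset_class G (coset_gset G H), \<zero>\<^bsub>S\<^esub>)"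
  have x: "?x \<in> carrier S" using admissible_coset[OF assms] by (rule S_carrierI)
  then have C: "?C \<in> carrier (burnside_ring G Tr)"
    unfolding burnside_ring_def using semiring.zero_closed by (rule semiring.groth_carrierI)
  have "burnside_mark K ?C = int (card (fixed_points K (coset_gset G H)))" if "K \<in> J" for K
    using semiring.the_elem_diff_cls[of "(?x, \<zero>\<^bsub>S\<^esub>)", OF _ that] x semiring.zero_closed semiring.m_zero[OF that]
      admissible_finite[OF admissible_coset[OF assms]] J_subset[OF that]
    by (simp add: burnside_mark_def semiring.diff_def class_mark_class)
  then show ?thesis using realizable_mark[OF C, of 1] by (simp add: realizable_def)
qed

lemma realizable_conj:
  assumes "realizable f" "K \<in> J" "g \<in> carrier G"
  shows "f (conj g K) = f K"
  using assms mark_map_conj J_conj unfolding realizable_def by metis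

text \<open>The marks of \<open>G/H\<close> or those of \<open>G/K\<close> differ at
  \<open>H\<close> and \<open>K\<close>; an affine change of scale turns the two values into 1 and
  0.\<close>

lemma realizable_separating:
  assumes "H \<in> J" "K \<in> J" "\<And>g. g \<in> carrier G \<Longrightarrow> K \<noteq> conj g H"
  shows "\<exists>u. realizable u \<and> u H = 1 \<and> u K = 0"
proof -
  define m :: "'a set \<Rightarrow> 'a set \<Rightarrow> rat"
    where "m L M = of_nat (card (fixed_points M (coset_gset G L)))" for L M
  have nz: "m L M \<noteq> 0 \<longleftrightarrow> (\<exists>a\<in>carrier G. M \<subseteq> conj a L)" if "L \<in> J" "M \<in> J" for L M
    using fixed_points_coset_nonempty[OF J_subgroup[OF that(1)] J_subset[OF that(2)]]
      finite_fixed_points[OF finite_coset_gset[OF finite_carrier J_subgroup[OF that(1)]]]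
    by (simp add: m_def)
  have self: "m L L \<noteq> 0" if "L \<in> J" for L
    unfolding nz[OF that that] using conj_subgroup_one[OF J_subset[OF that]]
    by (intro bexI[OF _ one_closed]) simp
  \<comment> \<open>If both marks were nonzero, each of \<open>H\<close> and \<open>K\<close> would
    lie in a conjugate of the other; comparing orders, they would be conjugate.\<close>
  have "m H K = 0 \<or> m K H = 0"
  proof (rule ccontr)
    assume "\<not> ?thesis"
    then have "m H K \<noteq> 0" "m K H \<noteq> 0" by simp_all
    then obtain a b where a: "a \<in> carrier G" "K \<subseteq> conj a H" and b: "b \<in> carrier G" "H \<subseteq> conj b K"
      unfolding nz[OF assms(1,2)] nz[OF assms(2,1)] by blast
    have fin: "finite (conj g L)" if "L \<in> J" "g \<in> carrier G" for g L
      using finite_carrier J_subset[OF J_conj[OF that]] by (rule rev_finite_subset)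
    have "card (conj a H) = card H" "card (conj b K) = card K"
      using a(1) b(1) assms(1,2) by (simp_all add: card_conj_subgroup J_subset)
    then have "card (conj a H) \<le> card K" using card_mono[OF fin[OF assms(2) b(1)] b(2)] by simp
    then have "K = conj a H" using card_seteq[OF fin[OF assms(1) a(1)] a(2)] by simp
    then show False using assms(3) a by blast
  qed
  \<comment> \<open>\<open>L\<close> is the one of \<open>H\<close> and \<open>K\<close> whose coset
    set has mark zero at the other; its mark at itself is nonzero by \<open>self\<close>.\<close>
  then obtain L where L: "L \<in> J" "m L H - m L K \<noteq> 0"
  proof
    assume "m H K = 0"
    then show ?thesis using self[OF assms(1)] by (intro that[OF assms(1)]) simp
  next
    assume "m K H = 0"
    then show ?thesis using self[OF assms(2)] by (intro that[OF assms(2)]) simp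
  qed
  let ?u = "\<lambda>M. (m L M + (- m L K)) * (1 / (m L H - m L K)) :: rat"
  have "realizable ?u"
    using realizable_coset[OF L(1)] by (intro realizable_mult realizable_add realizable_const) (simp add: m_def)
  then show ?thesis using L(2) by (intro exI[of _ ?u]) simp
qed

text \<open>As in Lagrange interpolation, separating functions are multiplied, one for each subgroup
  not conjugate to \<open>H\<close>. On conjugates of \<open>H\<close> the value is 1 by
  \<open>realizable_conj\<close>.\<close>

lemma realizable_delta:
  assumes "H \<in> J"
  shows "\<exists>v. realizable v \<and> v H = 1 \<and> (\<forall>K\<in>J. (\<forall>g\<in>carrier G. K \<noteq> conj g H) \<longrightarrow> v K = 0)"
proof -
  have "\<exists>v. realizable v \<and> v H = 1 \<and> (\<forall>K\<in>M. (\<forall>g\<in>carrier G. K \<noteq> conj g H) \<longrightarrow> v K = 0)"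
    if "finite M" "M \<subseteq> J" for M
    using that
  proof (induction rule: finite_induct)
    case empty
    show ?case using realizable_const[of 1] by auto
  next
    case (insert K M)
    then obtain v where v: "realizable v" "v H = 1" "\<forall>K\<in>M. (\<forall>g\<in>carrier G. K \<noteq> conj g H) \<longrightarrow> v K = 0"
      by auto
    show ?case
    proof (cases "\<forall>g\<in>carrier G. K \<noteq> conj g H")
      case True
      then obtain u where "realizable u" "u H = 1" "u K = 0"
        using realizable_separating[OF assms, of K] insert.prems by blast
      then show ?thesis
        using v by (intro exI[of _ "\<lambda>K. v K * u K"]) (auto intro: realizable_mult)
    next
      case False
      then show ?thesis using v by blast
    qed
  qed
  then show ?thesis using finite_J by blast
qed

text \<open>Induction on the size of the support: subtracting \<open>f H\<close> times the function
  from \<open>realizable_delta\<close> clears the value at \<open>H\<close>.\<close>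

lemma realizable_class_function:
  assumes "\<And>K g. K \<in> J \<Longrightarrow> g \<in> carrier G \<Longrightarrow> f (conj g K) = f K"
  shows "realizable f"
  using assms
proof (induction "card {K \<in> J. f K \<noteq> 0}" arbitrary: f rule: less_induct)
  case less
  show ?case
  proof (cases "\<exists>H\<in>J. f H \<noteq> 0")
    case False
    then show ?thesis using realizable_const[of 0] by (auto simp: realizable_def)
  next
    case True
    then obtain H where H: "H \<in> J" "f H \<noteq> 0" by blast
    obtain v where v: "realizable v" "v H = 1" "\<And>K. K \<in> J \<Longrightarrow> (\<forall>g\<in>carrier G. K \<noteq> conj g H) \<Longrightarrow> v K = 0"
      using realizable_delta[OF H(1)] by blast
    let ?f = "\<lambda>K. f K - f H * v K"
    have "{K \<in> J. ?f K \<noteq> 0} \<subset> {K \<in> J. f K \<noteq> 0}"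
    proof
      show "{K \<in> J. ?f K \<noteq> 0} \<subseteq> {K \<in> J. f K \<noteq> 0}"
      proof
        fix K assume K: "K \<in> {K \<in> J. ?f K \<noteq> 0}"
        \<comment> \<open>Where \<open>f\<close> vanishes, \<open>K\<close> is not conjugate to
          \<open>H\<close>, since \<open>f\<close> is nonzero on the whole class of
          \<open>H\<close>; so \<open>v\<close> vanishes too and the support does not grow.\<close>
        have "v K = 0" if "f K = 0"
          using that less.prems[OF H(1)] H(2) K by (intro v(3)) auto
        then show "K \<in> {K \<in> J. f K \<noteq> 0}" using K by auto
      qed
      show "{K \<in> J. ?f K \<noteq> 0} \<noteq> {K \<in> J. f K \<noteq> 0}"
      proof -
        have "H \<notin> {K \<in> J. ?f K \<noteq> 0}" "H \<in> {K \<in> J. f K \<noteq> 0}" using H v(2) by simp_all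
        then show ?thesis by blast
      qed
    qed
    then have "realizable ?f"
      using finite_J less.prems realizable_conj[OF v(1)]
      by (intro less.hyps psubset_card_mono) auto
    then have "realizable (\<lambda>K. ?f K + f H * v K)"
      by (intro realizable_add realizable_mult realizable_const v(1))
    then show ?thesis by simp
  qed
qed

abbreviation "CF \<equiv> class_function_ring G Tr"

lemma mark_map_iso: "mark_map G Tr \<in> ring_iso B CF"
proof (rule ring_iso_memI)
  show cl: "mark_map G Tr x \<in> carrier CF" if "x \<in> carrier B" for x
    using that J_conj mark_map_conj[OF that]
    by (simp add: class_function_ring_def) (simp add: mark_map_def)
  have ext: "mark_map G Tr x = (\<lambda>K\<in>J. mark_map G Tr x K)" for x
    by (rule extensional_restrict[symmetric]) (simp add: mark_map_def)
  show "mark_map G Tr (x \<otimes>\<^bsub>B\<^esub> y) = mark_map G Tr x \<otimes>\<^bsub>CF\<^esub> mark_map G Tr y"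
    "mark_map G Tr (x \<oplus>\<^bsub>B\<^esub> y) = mark_map G Tr x \<oplus>\<^bsub>CF\<^esub> mark_map G Tr y"
    if "x \<in> carrier B" "y \<in> carrier B" for x y
    using that by (subst ext; force simp: class_function_ring_def rational.m_hom intro: restrict_ext)+
  show "mark_map G Tr \<one>\<^bsub>B\<^esub> = \<one>\<^bsub>CF\<^esub>"
    by (subst ext) (force simp: class_function_ring_def rational.m_hom intro: restrict_ext)
  show "bij_betw (mark_map G Tr) (carrier B) (carrier CF)"
  proof (rule bij_betw_imageI)
    show "inj_on (mark_map G Tr) (carrier B)"
      by (rule inj_onI, rule rational.m_inj) auto
    show "mark_map G Tr ` carrier B = carrier CF"
    proof (intro equalityI subsetI)
      fix f assume f: "f \<in> carrier CF"
      then have "realizable f"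
        by (intro realizable_class_function) (auto simp: class_function_ring_def)
      then obtain Z where Z: "Z \<in> carrier B" "\<And>K. K \<in> J \<Longrightarrow> mark_map G Tr Z K = f K"
        by (auto simp: realizable_def)
      have "f \<in> extensional J" "mark_map G Tr Z \<in> extensional J"
        using f by (auto simp: class_function_ring_def mark_map_def)
      then have "f = mark_map G Tr Z"
        by (rule extensionalityI) (use Z in simp)
      then show "f \<in> mark_map G Tr ` carrier B" using Z(1) by blast
    qed (use cl in blast)
  qed
qed

subsection \<open>The idempotents\<close>

abbreviation conj_rel :: "('a set \<times> 'a set) set" where
  "conj_rel \<equiv> {(H, K). H \<in> J \<and> K \<in> J \<and> (\<exists>g \<in> carrier G. K = conj g H)}"

lemma equiv_conj: "equiv J conj_rel"
proof (rule equivI)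
  show "conj_rel \<subseteq> J \<times> J" by auto
  show "refl_on J conj_rel"
  proof (rule refl_onI)
    fix H assume H: "H \<in> J"
    then have "\<exists>g\<in>carrier G. H = conj g H"
      using conj_subgroup_one[OF J_subset[OF H]] by (intro bexI[OF _ one_closed]) simp
    then show "(H, H) \<in> conj_rel" using H by simp
  qed
  show "sym conj_rel"
  proof (rule symI)
    fix H K assume "(H, K) \<in> conj_rel"
    then obtain g where g: "H \<in> J" "K \<in> J" "g \<in> carrier G" "K = conj g H" by auto
    then have "H = conj (inv g) K" by (simp add: conj_subgroup_inv J_subset)
    then show "(K, H) \<in> conj_rel" using g inv_closed[OF g(3)] by blast
  qed
  show "trans conj_rel"
  proof (rule transI)
    fix H K L assume "(H, K) \<in> conj_rel" "(K, L) \<in> conj_rel"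
    then obtain g h where g: "H \<in> J" "L \<in> J" "g \<in> carrier G" "K = conj g H" "h \<in> carrier G" "L = conj h K"
      by auto
    then have "L = conj (h \<otimes> g) H" by (simp add: conj_subgroup_mult J_subset)
    then show "(H, L) \<in> conj_rel" using g m_closed[OF g(5,3)] by blast
  qed
qed

abbreviation Cl :: "'a set set set" where "Cl \<equiv> transfer_classes G Tr"

lemma finite_classes: "finite Cl"
  unfolding transfer_classes_def by (rule finite_quotient[OF finite_J]) auto

lemma ex1_class:
  assumes "K \<in> J"
  shows "\<exists>!\<C>. \<C> \<in> Cl \<and> K \<in> \<C>"
proof (rule ex1I[of _ "conj_rel `` {K}"])
  show "conj_rel `` {K} \<in> Cl \<and> K \<in> conj_rel `` {K}"
    unfolding transfer_classes_def
    using equiv_class_self[OF equiv_conj assms] quotientI[OF assms, of conj_rel] by blast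
  then show "\<C> = conj_rel `` {K}" if "\<C> \<in> Cl \<and> K \<in> \<C>" for \<C>
    using that quotient_disj[OF equiv_conj, of \<C> "conj_rel `` {K}"]
    unfolding transfer_classes_def by blast
qed

lemma class_subset:
  assumes "\<C> \<in> Cl"
  shows "\<C> \<subseteq> J"
  using assms unfolding transfer_classes_def by (rule in_quotient_imp_subset[OF equiv_conj])

lemma class_conj:
  assumes "\<C> \<in> Cl" "H \<in> \<C>" "K \<in> \<C>"
  shows "\<exists>g\<in>carrier G. K = conj g H"
proof -
  have "(H, K) \<in> conj_rel"
    using assms unfolding transfer_classes_def
    by (intro in_quotient_imp_in_rel[OF equiv_conj, of \<C>]) simp_all
  then show ?thesis by simp
qed

lemma conj_class:
  assumes "\<C> \<in> Cl" "H \<in> \<C>" "g \<in> carrier G"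
  shows "conj g H \<in> \<C>"
proof -
  have "H \<in> J" using assms class_subset by blast
  then have "(H, conj g H) \<in> conj_rel" using assms(3) J_conj by auto
  then show ?thesis
    by (rule in_quotient_imp_closed[OF equiv_conj assms(1)[unfolded transfer_classes_def] assms(2)])
qed

lemma conj_class_iff:
  assumes "\<C> \<in> Cl" "H \<in> J" "g \<in> carrier G"
  shows "conj g H \<in> \<C> \<longleftrightarrow> H \<in> \<C>"
  using conj_class[OF assms(1) _ assms(3), of H] conj_class[OF assms(1) _ inv_closed[OF assms(3)], of "conj g H"]
    conj_subgroup_inv[OF J_subset[OF assms(2)] assms(3)] by auto

abbreviation e where "e \<equiv> burnside_idempotent G Tr"

text \<open>\<open>inv_into\<close> yields a true preimage only for functions in the image of
  \<open>mark_map\<close>. The characteristic function lies there because conjugation preserves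
  membership in a class.\<close>

lemma idempotent_mark:
  assumes "\<C> \<in> Cl"
  shows "e \<C> \<in> carrier B" "mark_map G Tr (e \<C>) = char_function G Tr \<C>"
proof -
  have "char_function G Tr \<C> \<in> carrier CF"
    by (simp add: class_function_ring_def char_function_def J_conj conj_class_iff[OF assms])
  then have img: "char_function G Tr \<C> \<in> mark_map G Tr ` carrier B"
    using ring_iso_memE(5)[OF mark_map_iso] by (simp add: bij_betw_def)
  then show "e \<C> \<in> carrier B" "mark_map G Tr (e \<C>) = char_function G Tr \<C>"
    unfolding burnside_idempotent_def using inv_into_into[OF img] f_inv_into_f[OF img] by blast+
qed

lemma idempotent_mark_at: "\<C> \<in> Cl \<Longrightarrow> K \<in> J \<Longrightarrow> mark_map G Tr (e \<C>) K = (if K \<in> \<C> then 1 else 0)"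
  by (simp add: idempotent_mark(2) char_function_def)

lemma sum_idempotent_marks:
  assumes "K \<in> J"
  shows "(\<Sum>\<C>\<in>Cl. mark_map G Tr (e \<C>) K) = 1"
proof -
  obtain \<D> where D: "\<D> \<in> Cl" "K \<in> \<D>" "\<And>\<C>. \<C> \<in> Cl \<Longrightarrow> K \<in> \<C> \<Longrightarrow> \<C> = \<D>"
    using ex1_class[OF assms] by blast
  have "(\<Sum>\<C>\<in>Cl. mark_map G Tr (e \<C>) K) = (\<Sum>\<C>\<in>Cl. if \<C> = \<D> then 1 else 0)"
  proof (rule sum.cong)
    fix \<C> assume C: "\<C> \<in> Cl"
    then have "K \<in> \<C> \<longleftrightarrow> \<C> = \<D>" using D by blast
    then show "mark_map G Tr (e \<C>) K = (if \<C> = \<D> then 1 else 0)"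
      by (simp add: idempotent_mark_at[OF C assms])
  qed simp
  then show ?thesis using D(1) finite_classes by simp
qed

lemma orthogonal_decomposition: "orthogonal_decomposition B Cl e"
  unfolding orthogonal_decomposition_def
proof (intro conjI ballI impI)
  interpret cring B by (rule rational.cring)
  show "finite Cl" by (rule finite_classes)
  show "ring_idempotent B (e \<C>)" if "\<C> \<in> Cl" for \<C>
    unfolding ring_idempotent_def
  proof
    show "e \<C> \<otimes>\<^bsub>B\<^esub> e \<C> = e \<C>"
      by (rule rational.m_inj)
        (simp_all add: idempotent_mark(1)[OF that] idempotent_mark_at[OF that] rational.closed rational.m_hom)
  qed (rule idempotent_mark(1)[OF that])
  show "ring_orthogonal B (e \<C>) (e \<D>)" if "\<C> \<in> Cl" "\<D> \<in> Cl" "\<C> \<noteq> \<D>" for \<C> \<D>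
  proof -
    note cl = idempotent_mark(1)[OF that(1)] idempotent_mark(1)[OF that(2)]
    have "mark_map G Tr (e \<C>) K * mark_map G Tr (e \<D>) K = 0" if K: "K \<in> J" for K
    proof -
      have "K \<notin> \<C> \<or> K \<notin> \<D>"
        using ex1_class[OF K] \<open>\<C> \<in> Cl\<close> \<open>\<D> \<in> Cl\<close> \<open>\<C> \<noteq> \<D>\<close> by blast
      then show ?thesis using \<open>\<C> \<in> Cl\<close> \<open>\<D> \<in> Cl\<close> K by (auto simp: idempotent_mark_at)
    qed
    then have "e \<C> \<otimes>\<^bsub>B\<^esub> e \<D> = \<zero>\<^bsub>B\<^esub>"
      using cl by (intro rational.m_inj) (simp_all add: rational.closed rational.m_hom)
    then show ?thesis unfolding ring_orthogonal_def using m_comm[OF cl] by simp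
  qed
  show "\<one>\<^bsub>B\<^esub> = (\<Oplus>\<^bsub>B\<^esub>\<C>\<in>Cl. e \<C>)"
  proof (rule rational.m_inj)
    fix K assume K: "K \<in> J"
    show "mark_map G Tr \<one>\<^bsub>B\<^esub> K = mark_map G Tr (\<Oplus>\<^bsub>B\<^esub>\<C>\<in>Cl. e \<C>) K"
      using rational.m_finsum[OF K finite_classes, of e] idempotent_mark(1) K
      by (simp add: sum_idempotent_marks rational.m_one)
  qed (auto intro: finsum_closed idempotent_mark(1))
qed

text \<open>Both parts of a splitting would have marks 0 or 1, supported in one conjugacy class.
  Being nonzero and conjugation invariant, both would be 1 on that whole class, against
  orthogonality.\<close>

lemma maximal_decomposition: "maximal_orthogonal_decomposition B Cl e"
  unfolding maximal_orthogonal_decomposition_def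
proof (intro conjI orthogonal_decomposition ballI notI)
  fix \<C> assume C: "\<C> \<in> Cl"
    and "\<exists>a b. ring_idempotent B a \<and> ring_idempotent B b \<and> a \<noteq> \<zero>\<^bsub>B\<^esub> \<and> b \<noteq> \<zero>\<^bsub>B\<^esub> \<and>
      ring_orthogonal B a b \<and> e \<C> = a \<oplus>\<^bsub>B\<^esub> b"
  then obtain a b where ab: "a \<in> carrier B" "b \<in> carrier B" "a \<otimes>\<^bsub>B\<^esub> a = a" "b \<otimes>\<^bsub>B\<^esub> b = b"
    "a \<noteq> \<zero>\<^bsub>B\<^esub>" "b \<noteq> \<zero>\<^bsub>B\<^esub>" "a \<otimes>\<^bsub>B\<^esub> b = \<zero>\<^bsub>B\<^esub>" "e \<C> = a \<oplus>\<^bsub>B\<^esub> b"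
    by (auto simp: ring_idempotent_def ring_orthogonal_def)
  let ?m = "mark_map G Tr"
  have sum: "?m a K + ?m b K = (if K \<in> \<C> then 1 else 0)" if "K \<in> J" for K
    using idempotent_mark_at[OF C that] ab that by (simp add: rational.m_add)
  have prod: "?m a K * ?m b K = 0" if "K \<in> J" for K
    using rational.m_mult[OF that ab(1,2)] ab(7) rational.m_zero[OF that] by simp
  have idem: "?m x K = 0 \<or> ?m x K = 1" if "x \<in> carrier B" "x \<otimes>\<^bsub>B\<^esub> x = x" "K \<in> J" for x K
    using rational.m_mult[OF that(3,1,1)] that(2) by simp
  have supp: "\<exists>K\<in>\<C>. ?m x K = 1"
    if x: "x \<in> carrier B" "x \<otimes>\<^bsub>B\<^esub> x = x" "x \<noteq> \<zero>\<^bsub>B\<^esub>" and "x = a \<or> x = b" for x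
  proof -
    obtain K where K: "K \<in> J" "?m x K \<noteq> 0"
      using rational.m_inj[OF x(1) rational.zero_closed] rational.m_zero x(3) by metis
    then have "?m x K = 1" using idem[OF x(1,2)] by blast
    \<comment> \<open>The marks of \<open>a\<close> and \<open>b\<close> are 0 or 1 and one of them
      is 1, so their sum, the mark of the idempotent at \<open>K\<close>, is nonzero.\<close>
    moreover have "K \<in> \<C>"
      using \<open>?m x K = 1\<close> sum[OF K(1)] idem[OF ab(1,3) K(1)] idem[OF ab(2,4) K(1)] that(4)
      by (auto split: if_splits)
    ultimately show ?thesis by blast
  qed
  obtain H K where H: "H \<in> \<C>" "?m a H = 1" and K: "K \<in> \<C>" "?m b K = 1"
    using supp ab by metis
  obtain g where "g \<in> carrier G" "K = conj g H" using class_conj[OF C H(1) K(1)] by blast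
  then have "?m b H = 1"
    using mark_map_conj[OF ab(2)] K(2) H(1) class_subset[OF C] by auto
  then show False using prod[of H] H class_subset[OF C] by auto
qed

end

theorem theorem1:
  fixes G :: "('a, 'b) monoid_scheme" and Tr :: "('a set \<times> 'a set) set"
  assumes "group G" and "finite (carrier G)" and "transfer_system G Tr"
  shows "mark_map G Tr \<in> ring_iso (rat_burnside_ring G Tr) (class_function_ring G Tr) \<and>
    (\<forall>\<C> \<in> transfer_classes G Tr.
       burnside_idempotent G Tr \<C> \<in> carrier (rat_burnside_ring G Tr) \<and>
       mark_map G Tr (burnside_idempotent G Tr \<C>) = char_function G Tr \<C>) \<and>
    maximal_orthogonal_decomposition (rat_burnside_ring G Tr)
      (transfer_classes G Tr) (burnside_idempotent G Tr)"
proof -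
  interpret finite_group_transfer G Tr
    by (intro finite_group_transfer.intro finite_group_transfer_axioms.intro assms)
  show ?thesis using mark_map_iso idempotent_mark maximal_decomposition by blast
qed

end
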